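(* Let $p\in P^{Log}$, $k\in\mathbb{N}$, and let $D_{\sigma,k}$ be the Bernstein singular integral formed with $r:=\lceil\frac12(k+2)\rceil$. There is a constant $C>0$ depending only on $p$ and $k$ such that for every $\sigma>0$ and every $f\in W_k^{p(\cdot)}$, $$\|f-D_{\sigma,k}f\|_{p(\cdot)}\le\frac{C}{\sigma^k}\,\|f^{(k)}\|_{p(\cdot)}.$$
   Context: $P$ is the class of measurable functions $p:\mathbb{R}\to[1,\infty)$ with $1\le \operatorname{ess\,inf}_{x\in\mathbb{R}}p(x)$ and $\operatorname{ess\,sup}_{x\in\mathbb{R}}p(x)<\infty$. $P^{Log}$ is the class of $p\in P$ for which there exist constants $c_1,c_2>0$ and $c_3\in\mathbb{R}$ with $|p(x)-p(y)|\ln(e+1/|x-y|)\le c_1$ for all $x,y\in\mathbb{R}$ and $|p(x)-c_3|\ln(e+|x|)\le c_2$ for all $x\in\mathbb{R}$. For $p\in P$, $L^{p(\cdot)}=L^{p(\cdot)}(\mathbb{R})$ is the Banach space of measurable $f:\mathbb{R}\to\mathbb{C}$ with $I_{p(\cdot)}(f/\lambda):=\int_{\mathbb{R}}|f(y)/\lambda|^{p(y)}dy<\infty$ for some $\lambda>0$, with norm $\|f\|_{p(\cdot)}=\inf\{\eta>0: I_{p(\cdot)}(f/\eta)<1\}$. For $k\in\mathbb{N}=\{1,2,\dots\}$, $W_k^{p(\cdot)}$ is the class of $f\in L^{p(\cdot)}$ such that $f^{(k-1)}$ is absolutely continuous and $f^{(k)}\in L^{p(\cdot)}$. For $r,k\in\mathbb{N}$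 with $r\ge\frac12(k+2)$ and $\sigma>0$ put $g(\sigma,r,x)=\left(\frac1x\sin\frac{\sigma x}{2r}\right)^{2r}$, $G(\sigma,r,k,\zeta)=\sum_{v=1}^k(-1)^{k-v}\frac1v\binom kv g\left(\sigma,r,\frac{\zeta}{v}\right)$, $\gamma_{r,\sigma}=\int_{\mathbb{R}}\left(\frac1t\sin\frac{\sigma t}{2r}\right)^{2r}dt$. The Bernstein singular integral is $D_{\sigma,k}f(x):=\frac{(-1)^{k+1}}{\gamma_{r,\sigma}}\int_{\mathbb{R}}f(u)\,G(\sigma,r,k,u-x)\,du$ for measurable complex-valued $f$ with $\int_{\mathbb{R}}\frac{|f(u)|}{1+u^{2r}}du<\infty$. Here $\lceil a\rceil=\min\{n\in\mathbb{N}:n\ge a\}$. *)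

theory Defs
  imports "HOL-Analysis.Analysis" "HOL-Probability.Essential_Supremum"
begin

text \<open>Measurability and integration on the real line are always with respect to Lebesgue measure
  on the Lebesgue measurable sets (the library's \<open>lebesgue\<close>).\<close>

text \<open>Dual to the library's \<open>esssup\<close>, and with the same convention for non-measurable functions.\<close>

definition essinf :: "'a measure \<Rightarrow> ('a \<Rightarrow> ereal) \<Rightarrow> ereal" where
  "essinf M f = (if f \<in> borel_measurable M then Liminf (ae_filter M) f else bot)"

definition exponents :: "(real \<Rightarrow> real) set" where
  "exponents = {p. p \<in> borel_measurable lebesgue \<and> (\<forall>x. 1 \<le> p x) \<and>
     1 \<le> essinf lebesgue (\<lambda>x. ereal (p x)) \<and> esssup lebesgue (\<lambda>x. ereal (p x)) < \<infinity>}"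

text \<open>For \<open>x = y\<close> the first inequality reads \<open>0 \<le> c1\<close>, whatever the value of \<open>1 / 0\<close>.\<close>

definition log_exponents :: "(real \<Rightarrow> real) set" where
  "log_exponents = {p \<in> exponents. \<exists>c1 c2 c3. c1 > 0 \<and> c2 > 0 \<and>
     (\<forall>x y. \<bar>p x - p y\<bar> * ln (exp 1 + 1 / \<bar>x - y\<bar>) \<le> c1) \<and>
     (\<forall>x. \<bar>p x - c3\<bar> * ln (exp 1 + \<bar>x\<bar>) \<le> c2)}"

definition modular :: "(real \<Rightarrow> real) \<Rightarrow> (real \<Rightarrow> complex) \<Rightarrow> ennreal" where
  "modular p f = (\<integral>\<^sup>+ y. ennreal (cmod (f y) powr p y) \<partial>lebesgue)"

definition Lp_var :: "(real \<Rightarrow> real) \<Rightarrow> (real \<Rightarrow> complex) set" where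
  "Lp_var p = {f \<in> borel_measurable lebesgue.
     \<exists>l>0. modular p (\<lambda>x. f x / complex_of_real l) < \<infinity>}"

text \<open>Meaningful for \<open>f \<in> Lp_var p\<close>, where the set below is nonempty (for \<open>p \<in> exponents\<close>).\<close>

definition norm_var :: "(real \<Rightarrow> real) \<Rightarrow> (real \<Rightarrow> complex) \<Rightarrow> real" where
  "norm_var p f = Inf {\<eta>. \<eta> > 0 \<and> modular p (\<lambda>x. f x / complex_of_real \<eta>) < 1}"

definition abs_continuous :: "(real \<Rightarrow> complex) \<Rightarrow> bool" where
  "abs_continuous f \<longleftrightarrow> (\<forall>\<epsilon>>0. \<exists>\<delta>>0. \<forall>(n::nat) a b.
     (\<forall>i<n. a i \<le> b i) \<and> disjoint_family_on (\<lambda>i. {a i<..<b i}) {..<n} \<and>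
     (\<Sum>i<n. b i - a i) < \<delta> \<longrightarrow> (\<Sum>i<n. cmod (f (b i) - f (a i))) < \<epsilon>)"

text \<open>At points where the previous derivative is not differentiable, the value is an unspecified
  constant (that of \<open>vector_derivative\<close>).  In \<open>sobolev\<close> below this can only happen for the derivative
  of highest order, on a null set.\<close>

fun nth_deriv :: "nat \<Rightarrow> (real \<Rightarrow> complex) \<Rightarrow> real \<Rightarrow> complex" where
  "nth_deriv 0 f = f"
| "nth_deriv (Suc j) f = (\<lambda>x. vector_derivative (nth_deriv j f) (at x))"

text \<open>Intended for \<open>k \<ge> 1\<close>.  Elements are functions, not classes modulo null sets.  The derivatives
  below order \<open>k\<close> exist everywhere; the one of order \<open>k\<close> exists almost everywhere, by absolute
  continuity of the one of order \<open>k - 1\<close>.\<close>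

definition sobolev :: "nat \<Rightarrow> (real \<Rightarrow> real) \<Rightarrow> (real \<Rightarrow> complex) set" where
  "sobolev k p = {f \<in> Lp_var p.
     (\<forall>j<k - 1. \<forall>x. nth_deriv j f differentiable at x) \<and>
     abs_continuous (nth_deriv (k - 1) f) \<and>
     nth_deriv k f \<in> Lp_var p}"

definition bernstein_g :: "real \<Rightarrow> nat \<Rightarrow> real \<Rightarrow> real" where
  "bernstein_g \<sigma> r x = (1 / x * sin (\<sigma> * x / (2 * real r))) ^ (2 * r)"

definition bernstein_G :: "real \<Rightarrow> nat \<Rightarrow> nat \<Rightarrow> real \<Rightarrow> real" where
  "bernstein_G \<sigma> r k \<zeta> =
     (\<Sum>v=1..k. (-1) ^ (k - v) * (1 / real v) * real (k choose v) * bernstein_g \<sigma> r (\<zeta> / real v))"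

definition bernstein_gamma :: "nat \<Rightarrow> real \<Rightarrow> real" where
  "bernstein_gamma r \<sigma> = (LINT t|lebesgue. (1 / t * sin (\<sigma> * t / (2 * real r))) ^ (2 * r))"

definition bernstein_domain :: "nat \<Rightarrow> (real \<Rightarrow> complex) set" where
  "bernstein_domain r = {f \<in> borel_measurable lebesgue.
     (\<integral>\<^sup>+ u. ennreal (cmod (f u) / (1 + u ^ (2 * r))) \<partial>lebesgue) < \<infinity>}"

text \<open>Meaningful for \<open>f \<in> bernstein_domain r\<close>, where the integrand is integrable.\<close>

definition bernstein_D :: "real \<Rightarrow> nat \<Rightarrow> nat \<Rightarrow> (real \<Rightarrow> complex) \<Rightarrow> real \<Rightarrow> complex" where
  "bernstein_D \<sigma> r k f x =
     complex_of_real ((-1) ^ (k + 1) / bernstein_gamma r \<sigma>) *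
     (LINT u|lebesgue. f u * complex_of_real (bernstein_G \<sigma> r k (u - x)))"

end

theory Submission
  imports Defs "HOL-Probability.Sinc_Integral"
begin

text \<open>Why the estimate holds.  Substitution in the defining integral gives
  \<open>f x - D f x = ((-1) ^ k / \<gamma>) * \<integral> g t * \<Delta> t ^ k f x dt\<close>, where \<open>\<Delta> t ^ k\<close> is the forward difference of order \<open>k\<close>
  with step \<open>t\<close> (\<open>diff_bernstein_D_eq\<close>).  The mean value inequality for the derivatives of order below
  \<open>k\<close> and the fundamental theorem of calculus for the last, absolutely continuous one bound \<open>\<Delta> t ^ k f x\<close> by \<open>2 * k * \<bar>t\<bar> ^ k\<close>
  times the average of the modulus of the derivative of order \<open>k\<close> over the interval of radius \<open>k * \<bar>t\<bar>\<close> about \<open>x\<close>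
  (\<open>sobolev_forward_difference_le\<close>).  So the error is dominated by a mixture of such averages with
  weight proportional to \<open>g t * \<bar>t\<bar> ^ k\<close>.  The total mass of the mixture, relative to \<open>\<gamma>\<close>, is finite because \<open>k + 2 \<le> 2 * r\<close>, and it
  is a constant multiple of \<open>1 / \<sigma> ^ k\<close> because \<open>g\<close> is a multiple of a dilation of a fixed function.

  It remains to bound the averages over intervals of radius \<open>t\<close> on the variable exponent space,
  uniformly in \<open>t > 0\<close> (\<open>modular_avg_le\<close>).  If the modular of \<open>h \<ge> 0\<close> is at most \<open>1\<close>, split \<open>h\<close> at height \<open>1\<close>.  For the large
  values, the oscillation of the exponent over a short interval of length \<open>2 * t\<close> is \<open>O(1 / ln (1 / t))\<close>, and a power of \<open>1 / t\<close>
  with such an exponent is bounded; over a long interval the average is at most \<open>1\<close>.  For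
  the small values, the decay condition allows to exchange the exponent with its limit at infinity, up to an integrable
  error.  In both cases Jensen's inequality for a constant exponent then gives a bound of the modular, also when the exponent
  takes the value \<open>1\<close>.  Jensen's inequality for the mixture and homogeneity conclude the proof.

  The fundamental theorem of calculus rests on the almost everywhere differentiability of absolutely
  continuous functions.  It is proved directly, without a decomposition into monotone functions:
  if the upper and the lower derivates differed on a set of positive measure, a Vitali cover of it by
  intervals of steep ascent, refined by a second cover by intervals of descent, would give increments that
  contradict absolute continuity (\<open>steep_up_and_down_null\<close>).\<close>

section \<open>Absolute continuity along divisions\<close>

text \<open>Absolute continuity tested on finite families of nonoverlapping compact intervals, in the
  \<open>division_of\<close> form in which Vitali covers and Henstock--Kurzweil partitions deliver such families.\<close>

definition ac_on_divisions :: "(real \<Rightarrow> 'a::real_normed_vector) \<Rightarrow> bool" where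
  "ac_on_divisions f \<longleftrightarrow> (\<forall>\<epsilon>>0. \<exists>\<delta>>0. \<forall>D. D division_of \<Union>D \<and> (\<Sum>K\<in>D. measure lborel K) < \<delta> \<longrightarrow>
     (\<Sum>K\<in>D. norm (f (Sup K) - f (Inf K))) < \<epsilon>)"

lemma ac_on_divisionsE:
  assumes "ac_on_divisions f" "\<epsilon> > 0"
  obtains \<delta> where "\<delta> > 0"
    "\<And>D. \<lbrakk>D division_of \<Union>D; (\<Sum>K\<in>D. measure lborel K) < \<delta>\<rbrakk> \<Longrightarrow> (\<Sum>K\<in>D. norm (f (Sup K) - f (Inf K))) < \<epsilon>"
proof -
  from assms obtain \<delta> where "\<delta> > 0" and
    "\<forall>D. D division_of \<Union>D \<and> (\<Sum>K\<in>D. measure lborel K) < \<delta> \<longrightarrow> (\<Sum>K\<in>D. norm (f (Sup K) - f (Inf K))) < \<epsilon>"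
    unfolding ac_on_divisions_def by meson
  then show thesis by (intro that[of \<delta>]) simp_all
qed

lemma division_interval_real:
  fixes D :: "real set set"
  assumes "D division_of S" "K \<in> D"
  shows "Inf K \<le> Sup K" "K = {Inf K..Sup K}" "measure lborel K = Sup K - Inf K"
proof -
  obtain u v where K: "K = {u..v}" "K \<noteq> {}"
    using assms by (metis box_real(2) division_ofD(3,4))
  then have "u \<le> v" by auto
  then show "Inf K \<le> Sup K" "K = {Inf K..Sup K}" "measure lborel K = Sup K - Inf K"
    using K by auto
qed

lemma abs_continuous_imp_ac_on_divisions:
  assumes "abs_continuous f"
  shows "ac_on_divisions f"
  unfolding ac_on_divisions_def
proof (intro allI impI)
  fix \<epsilon> :: real assume "\<epsilon> > 0"
  then obtain \<delta> where \<delta>: "\<delta> > 0" and ac: "\<And>(n::nat) a b. (\<forall>i<n. a i \<le> b i) \<Longrightarrow>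
      disjoint_family_on (\<lambda>i. {a i<..<b i}) {..<n} \<Longrightarrow> (\<Sum>i<n. b i - a i) < \<delta> \<Longrightarrow>
      (\<Sum>i<n. cmod (f (b i) - f (a i))) < \<epsilon>"
    using assms unfolding abs_continuous_def by meson
  show "\<exists>\<delta>>0. \<forall>D. D division_of \<Union>D \<and> (\<Sum>K\<in>D. measure lborel K) < \<delta> \<longrightarrow>
     (\<Sum>K\<in>D. norm (f (Sup K) - f (Inf K))) < \<epsilon>"
  proof (intro exI conjI allI impI)
    fix D :: "real set set" assume D: "D division_of \<Union>D \<and> (\<Sum>K\<in>D. measure lborel K) < \<delta>"
    then have fin: "finite D" by blast
    obtain e where e: "bij_betw e {..<card D} D"
      using ex_bij_betw_nat_finite[OF fin] by (auto simp: lessThan_atLeast0)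
    then have eD: "e i \<in> D" if "i < card D" for i
      using that by (auto simp: bij_betw_def)
    note iv = division_interval_real[OF conjunct1[OF D]]
    have int: "interior K = {Inf K<..<Sup K}" if "K \<in> D" for K
      using iv(2)[OF that] by (metis interior_atLeastAtMost_real)
    have "disjoint_family_on (\<lambda>i. {Inf (e i)<..<Sup (e i)}) {..<card D}"
      unfolding disjoint_family_on_def
    proof (intro ballI impI)
      fix m n assume mn: "m \<in> {..<card D}" "n \<in> {..<card D}" "m \<noteq> n"
      then have "e m \<noteq> e n" using e by (auto simp: bij_betw_def inj_on_def)
      then have "interior (e m) \<inter> interior (e n) = {}"
        using D eD mn by (meson division_ofD(5) lessThan_iff)
      then show "{Inf (e m)<..<Sup (e m)} \<inter> {Inf (e n)<..<Sup (e n)} = {}"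
        using int eD mn by auto
    qed
    moreover have "(\<Sum>i<card D. Sup (e i) - Inf (e i)) < \<delta>"
      using D iv(3) by (simp add: sum.reindex_bij_betw[OF e, of "\<lambda>K. Sup K - Inf K"])
    ultimately have "(\<Sum>i<card D. cmod (f (Sup (e i)) - f (Inf (e i)))) < \<epsilon>"
      using iv(1) eD by (intro ac) auto
    then show "(\<Sum>K\<in>D. norm (f (Sup K) - f (Inf K))) < \<epsilon>"
      by (simp add: sum.reindex_bij_betw[OF e, of "\<lambda>K. cmod (f (Sup K) - f (Inf K))"])
  qed (fact \<delta>)
qed

lemma ac_on_divisions_bound:
  assumes "ac_on_divisions f" "c \<ge> 0" "\<And>x y. norm (g y - g x) \<le> c * norm (f y - f x)"
  shows "ac_on_divisions g"
  unfolding ac_on_divisions_def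
proof (intro allI impI)
  fix \<epsilon> :: real assume "\<epsilon> > 0"
  then have "\<epsilon> / (c + 1) > 0" using assms(2) by auto
  from ac_on_divisionsE[OF assms(1) this] obtain \<delta> where \<delta>: "\<delta> > 0"
    "\<And>D. \<lbrakk>D division_of \<Union>D; (\<Sum>K\<in>D. measure lborel K) < \<delta>\<rbrakk> \<Longrightarrow> (\<Sum>K\<in>D. norm (f (Sup K) - f (Inf K))) < \<epsilon> / (c + 1)"
    by blast
  have "(\<Sum>K\<in>D. norm (g (Sup K) - g (Inf K))) < \<epsilon>"
    if "D division_of \<Union>D" "(\<Sum>K\<in>D. measure lborel K) < \<delta>" for D
  proof -
    have "(\<Sum>K\<in>D. norm (g (Sup K) - g (Inf K))) \<le> c * (\<Sum>K\<in>D. norm (f (Sup K) - f (Inf K)))"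
      by (simp add: sum_distrib_left sum_mono assms(3))
    also have "\<dots> \<le> (c + 1) * (\<Sum>K\<in>D. norm (f (Sup K) - f (Inf K)))"
      by (intro mult_right_mono sum_nonneg) auto
    also have "\<dots> < \<epsilon>"
      using \<delta>(2)[OF that] assms(2) by (simp add: field_simps)
    finally show ?thesis .
  qed
  with \<delta>(1) show "\<exists>\<delta>>0. \<forall>D. D division_of \<Union>D \<and> (\<Sum>K\<in>D. measure lborel K) < \<delta> \<longrightarrow>
     (\<Sum>K\<in>D. norm (g (Sup K) - g (Inf K))) < \<epsilon>" by blast
qed

lemma ac_on_divisions_subtract_linear:
  fixes F :: "real \<Rightarrow> real"
  assumes "ac_on_divisions F"
  shows "ac_on_divisions (\<lambda>x. F x - c * x)"
  unfolding ac_on_divisions_def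
proof (intro allI impI)
  fix \<epsilon> :: real assume "\<epsilon> > 0"
  then have "\<epsilon> / 2 > 0" by auto
  from ac_on_divisionsE[OF assms(1) this] obtain \<delta> where \<delta>: "\<delta> > 0"
    "\<And>D. \<lbrakk>D division_of \<Union>D; (\<Sum>K\<in>D. measure lborel K) < \<delta>\<rbrakk> \<Longrightarrow> (\<Sum>K\<in>D. norm (F (Sup K) - F (Inf K))) < \<epsilon> / 2"
    by blast
  define \<delta>' where "\<delta>' = min \<delta> (\<epsilon> / (2 * (\<bar>c\<bar> + 1)))"
  have "(\<Sum>K\<in>D. norm ((F (Sup K) - c * Sup K) - (F (Inf K) - c * Inf K))) < \<epsilon>"
    if D: "D division_of \<Union>D" "(\<Sum>K\<in>D. measure lborel K) < \<delta>'" for D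
  proof -
    have "(\<Sum>K\<in>D. norm ((F (Sup K) - c * Sup K) - (F (Inf K) - c * Inf K)))
        \<le> (\<Sum>K\<in>D. norm (F (Sup K) - F (Inf K)) + \<bar>c\<bar> * measure lborel K)"
    proof (rule sum_mono)
      fix K assume "K \<in> D"
      note iv = division_interval_real[OF D(1) this]
      have "\<bar>c * Sup K - c * Inf K\<bar> = \<bar>c\<bar> * measure lborel K"
        using iv(1) unfolding iv(3) by (simp add: abs_mult flip: right_diff_distrib)
      then show "norm ((F (Sup K) - c * Sup K) - (F (Inf K) - c * Inf K))
          \<le> norm (F (Sup K) - F (Inf K)) + \<bar>c\<bar> * measure lborel K"
        by simp
    qed
    also have "\<dots> = (\<Sum>K\<in>D. norm (F (Sup K) - F (Inf K))) + \<bar>c\<bar> * (\<Sum>K\<in>D. measure lborel K)"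
      by (simp add: sum.distrib sum_distrib_left)
    also have "\<dots> < \<epsilon> / 2 + \<epsilon> / 2"
    proof (rule add_less_le_mono)
      show "(\<Sum>K\<in>D. norm (F (Sup K) - F (Inf K))) < \<epsilon> / 2"
        using D by (intro \<delta>(2)) (auto simp: \<delta>'_def)
      have "\<bar>c\<bar> * (\<Sum>K\<in>D. measure lborel K) \<le> (\<bar>c\<bar> + 1) * (\<epsilon> / (2 * (\<bar>c\<bar> + 1)))"
        using D by (intro mult_mono sum_nonneg) (auto simp: \<delta>'_def)
      also have "\<dots> = \<epsilon> / 2"
        by (simp add: field_simps)
      finally show "\<bar>c\<bar> * (\<Sum>K\<in>D. measure lborel K) \<le> \<epsilon> / 2" .
    qed
    finally show ?thesis by simp
  qed
  moreover have "\<delta>' > 0"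
    using \<delta>(1) \<open>\<epsilon> > 0\<close> by (auto simp: \<delta>'_def)
  ultimately show "\<exists>\<delta>>0. \<forall>D. D division_of \<Union>D \<and> (\<Sum>K\<in>D. measure lborel K) < \<delta> \<longrightarrow>
     (\<Sum>K\<in>D. norm ((F (Sup K) - c * Sup K) - (F (Inf K) - c * Inf K))) < \<epsilon>" by blast
qed

lemma ac_on_divisions_isCont:
  fixes f :: "real \<Rightarrow> 'a::real_normed_vector"
  assumes "ac_on_divisions f"
  shows "isCont f x"
  unfolding continuous_at_eps_delta
proof (intro allI impI)
  fix e :: real assume "e > 0"
  from ac_on_divisionsE[OF assms(1) this] obtain \<delta> where \<delta>: "\<delta> > 0"
    "\<And>D. \<lbrakk>D division_of \<Union>D; (\<Sum>K\<in>D. measure lborel K) < \<delta>\<rbrakk> \<Longrightarrow> (\<Sum>K\<in>D. norm (f (Sup K) - f (Inf K))) < e"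
    by blast
  have *: "norm (f v - f u) < e" if "u \<le> v" "v - u < \<delta>" for u v
  proof -
    have "{{u..v}} division_of \<Union>{{u..v}}"
      using division_of_self[of u v] that by simp
    from \<delta>(2)[OF this] that show ?thesis by simp
  qed
  have "dist (f x') (f x) < e" if "dist x' x < \<delta>" for x'
    using *[of x x'] *[of x' x] that by (cases "x \<le> x'") (auto simp: dist_norm norm_minus_commute)
  with \<delta>(1) show "\<exists>d>0. \<forall>x'. dist x' x < d \<longrightarrow> dist (f x') (f x) < e" by blast
qed

text \<open>Telescoping; the tagged version applies once every interval is tagged with its left endpoint.\<close>

lemma additive_division_real:
  fixes f :: "real \<Rightarrow> 'a::real_normed_vector"
  assumes "D division_of {a..b}" "a \<le> b"
  shows "(\<Sum>K\<in>D. f (Sup K) - f (Inf K)) = f b - f a"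
proof -
  let ?p = "(\<lambda>K. (Inf K, K)) ` D"
  have "?p tagged_division_of {a..b}"
  proof (rule tagged_division_ofI)
    show "finite ?p" using assms by auto
    fix x K assume "(x, K) \<in> ?p"
    then have x: "x = Inf K" "K \<in> D" by auto
    show "x \<in> K" using division_interval_real[OF assms(1) x(2)] x(1) by (metis atLeastAtMost_iff order_refl)
    show "K \<subseteq> {a..b}" "\<exists>u v. K = cbox u v" using assms x by blast+
    fix x' K' assume "(x', K') \<in> ?p" "(x, K) \<noteq> (x', K')"
    then show "interior K \<inter> interior K' = {}" using x assms by (auto dest: division_ofD(5))
  next
    show "\<Union>{K. \<exists>x. (x, K) \<in> ?p} = {a..b}"
    proof -
      have "{K. \<exists>x. (x, K) \<in> ?p} = D" by auto
      then show ?thesis using division_ofD(6)[OF assms(1)] by simp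
    qed
  qed
  then have "(\<Sum>(x, K)\<in>?p. f (Sup K) - f (Inf K)) = f b - f a"
    by (rule additive_tagged_division_1[OF assms(2)])
  then show ?thesis
    by (simp add: sum.reindex inj_on_def)
qed

lemma measure_Union_division:
  fixes D :: "real set set"
  assumes "D division_of \<Union>D"
  shows "\<Union>D \<in> lmeasurable" "measure lebesgue (\<Union>D) = (\<Sum>K\<in>D. measure lborel K)"
proof -
  have fin: "finite D" using assms by blast
  have lm: "K \<in> lmeasurable" if "K \<in> D" for K
    using division_ofD(4)[OF assms that] by auto
  show "\<Union>D \<in> lmeasurable"
    using fin lm by (intro fmeasurable.finite_Union) auto
  have "measure lebesgue (\<Union>D) = (\<Sum>K\<in>D. measure lebesgue K)"
  proof (rule measure_negligible_finite_Union[OF fin lm])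
    show "pairwise (\<lambda>S T. negligible (S \<inter> T)) D"
    proof (rule pairwiseI)
      fix S T assume ST: "S \<in> D" "T \<in> D" "S \<noteq> T"
      then have "interior S \<inter> interior T = {}" using assms by (auto dest: division_ofD(5))
      moreover obtain a b c d where "S = {a..b}" "T = {c..d}"
        using box_real(2) ST division_ofD(4)[OF assms] by metis
      ultimately show "negligible (S \<inter> T)"
        using negligible_interval(1)[of "max a c" "min b d"]
        by (auto simp flip: interior_Int)
    qed
  qed
  also have "\<dots> = (\<Sum>K\<in>D. measure lborel K)"
  proof (intro sum.cong refl)
    fix K assume "K \<in> D"
    then obtain a b where "K = cbox a b" using division_ofD(4)[OF assms] by meson
    then show "measure lebesgue K = measure lborel K" by (simp add: measure_completion)
  qed
  finally show "measure lebesgue (\<Union>D) = (\<Sum>K\<in>D. measure lborel K)" .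
qed

section \<open>Almost everywhere differentiability\<close>

text \<open>The countable disjoint family of Vitali's covering theorem exhausts \<open>S\<close> up to a null set, so
  by continuity of measure finitely many of its intervals exhaust \<open>S\<close> up to measure \<open>e\<close>.  A finite
  family is what absolute continuity can be applied to.\<close>

lemma Vitali_finite_cover_real:
  fixes S U :: "real set"
  assumes S: "S \<in> lmeasurable" and U: "open U" "S \<subseteq> U" and "e > 0"
    and cov: "\<And>x d. \<lbrakk>x \<in> S; d > 0\<rbrakk> \<Longrightarrow> \<exists>u v. u < x \<and> x < v \<and> v - u < d \<and> P u v"
  obtains D where "D division_of \<Union>D" "pairwise disjnt D" "\<Union>D \<subseteq> U"
    "\<And>K. K \<in> D \<Longrightarrow> P (Inf K) (Sup K)" "measure lebesgue (S - \<Union>D) < e"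
proof -
  define I where "I = {(u, v). u < v \<and> P u v \<and> {u..v} \<subseteq> U}"
  define c where "c = (\<lambda>(u, v). (u + v) / 2 :: real)"
  define r where "r = (\<lambda>(u, v). (v - u) / 2 :: real)"
  have cb: "cball (c i) (r i) = {fst i..snd i}" for i
    by (auto simp: c_def r_def dist_real_def split: prod.splits) (auto simp: abs_if field_simps split: if_splits)
  obtain C where C: "countable C" "C \<subseteq> I"
    and disj: "pairwise (\<lambda>i j. disjnt (cball (c i) (r i)) (cball (c j) (r j))) C"
    and neg: "negligible (S - (\<Union>i\<in>C. cball (c i) (r i)))"
  proof (rule Vitali_covering_theorem_cballs[of I r S c])
    show "0 < r i" if "i \<in> I" for i using that by (auto simp: I_def r_def)
    show "\<exists>i. i \<in> I \<and> x \<in> cball (c i) (r i) \<and> r i < d" if x: "x \<in> S" and "0 < d" for x d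
    proof -
      obtain d' where d': "d' > 0" "ball x d' \<subseteq> U"
        using U x by (meson open_contains_ball subsetD)
      obtain u v where uv: "u < x" "x < v" "v - u < min d d'" "P u v"
        using cov[OF x, of "min d d'"] d' \<open>0 < d\<close> by auto
      have "{u..v} \<subseteq> ball x d'"
        using uv by (auto simp: dist_real_def)
      then have "(u, v) \<in> I" using uv d' by (auto simp: I_def)
      moreover have "x \<in> cball (c (u, v)) (r (u, v))" using uv by (simp add: cb)
      moreover have "r (u, v) < d" using uv by (simp add: r_def)
      ultimately show ?thesis by blast
    qed
  qed
  let ?T = "\<lambda>i. S \<inter> {fst i..snd i}"
  have lmT: "?T i \<in> lmeasurable" for i
    using S by (intro fmeasurable.Int) auto
  obtain D' where D': "D' \<subseteq> ?T ` C" "finite D'" "measure lebesgue (\<Union>(?T ` C)) - e < measure lebesgue (\<Union>D')"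
  proof (rule measure_countable_Union_approachable[of "?T ` C" e "measure lebesgue S"])
    show "countable (?T ` C)" using C by auto
    show "d \<in> lmeasurable" if "d \<in> ?T ` C" for d using that lmT by auto
    show "measure lebesgue (\<Union>D') \<le> measure lebesgue S" if "D' \<subseteq> ?T ` C" "finite D'" for D'
    proof (rule measure_mono_fmeasurable)
      show "\<Union>D' \<subseteq> S" using that by auto
      have "d \<in> lmeasurable" if "d \<in> D'" for d using that \<open>D' \<subseteq> ?T ` C\<close> lmT by auto
      with \<open>finite D'\<close> show "\<Union>D' \<in> sets lebesgue"
        by (intro sets.finite_Union) (auto dest: fmeasurableD)
    qed (fact S)
    show "0 < e" by fact
  qed
  obtain C' where C': "C' \<subseteq> C" "finite C'" "D' = ?T ` C'"
    using finite_subset_image[OF D'(2,1)] by auto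
  define D where "D = (\<lambda>i. {fst i..snd i}) ` C'"
  have less: "fst i < snd i" if "i \<in> C'" for i
    using that C'(1) C(2) by (auto simp: I_def)
  have disjD: "pairwise disjnt D"
    using pairwise_subset[OF disj C'(1)] unfolding D_def cb
    by (auto simp: pairwise_image intro: pairwise_mono)
  have div: "D division_of \<Union>D"
  proof (rule division_ofI)
    show "finite D" using C' by (simp add: D_def)
    fix K assume "K \<in> D"
    then show "K \<subseteq> \<Union>D" "K \<noteq> {}" "\<exists>a b. K = cbox a b"
      using less by (auto simp: D_def order.strict_implies_order)
    fix K' assume "K' \<in> D" "K \<noteq> K'"
    with \<open>K \<in> D\<close> disjD have "K \<inter> K' = {}" by (auto simp: pairwise_def disjnt_def)
    then show "interior K \<inter> interior K' = {}" using interior_subset by blast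
  qed auto
  show thesis
  proof
    show "D division_of \<Union>D" "pairwise disjnt D" by fact+
    show "\<Union>D \<subseteq> U"
    proof -
      have "{fst i..snd i} \<subseteq> U" if "i \<in> C'" for i
      proof -
        have "i \<in> I" using that C'(1) C(2) by blast
        then show ?thesis by (simp add: I_def split_beta)
      qed
      then show ?thesis by (auto simp: D_def)
    qed
    show "P (Inf K) (Sup K)" if "K \<in> D" for K
    proof -
      obtain i where i: "i \<in> C'" "K = {fst i..snd i}" using \<open>K \<in> D\<close> unfolding D_def by blast
      then have "P (fst i) (snd i)" using C'(1) C(2) by (auto simp: I_def)
      then show ?thesis using less[OF i(1)] by (simp add: i(2))
    qed
    have lmC: "\<Union>(?T ` C) \<in> lmeasurable"
    proof (rule fmeasurableI2[OF S])
      show "\<Union>(?T ` C) \<in> sets lebesgue"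
        by (rule sets.countable_Union) (use C(1) lmT in \<open>auto intro: fmeasurableD\<close>)
    qed auto
    have eqS: "S - \<Union>(?T ` C) = S - (\<Union>i\<in>C. cball (c i) (r i))" by (auto simp: cb)
    have "measure lebesgue S = measure lebesgue (\<Union>(?T ` C))"
      by (rule measure_negligible_symdiff[OF S, symmetric])
         (rule negligible_subset[OF neg], auto simp: cb)
    moreover have "\<Union>D' = S \<inter> \<Union>D" by (auto simp: C' D_def)
    moreover have "measure lebesgue (S - \<Union>D) = measure lebesgue S - measure lebesgue (S \<inter> \<Union>D)"
    proof -
      have "measure lebesgue (S - S \<inter> \<Union>D) = measure lebesgue S - measure lebesgue (S \<inter> \<Union>D)"
        using S measure_Union_division(1)[OF div]
        by (intro measurable_measure_Diff) (auto simp: fmeasurableD)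
      moreover have "S - S \<inter> \<Union>D = S - \<Union>D" by blast
      ultimately show ?thesis by simp
    qed
    ultimately show "measure lebesgue (S - \<Union>D) < e"
      using D'(3) by simp
  qed
qed

text \<open>The points whose upper derivate exceeds \<open>c\<close>, up to the borderline case of equality.  Intervals
  that straddle the point with both endpoints distinct from it make the set visibly a countable
  intersection of open sets; a steep chord with an endpoint at the point is perturbed to such an interval
  by continuity.  Lower derivates are those of \<open>- F\<close>.\<close>

definition steep_points :: "(real \<Rightarrow> real) \<Rightarrow> real \<Rightarrow> real set" where
  "steep_points F c = {x. \<forall>d>0. \<exists>u v. u < x \<and> x < v \<and> v - u < d \<and> F v - F u > c * (v - u)}"

lemma steep_points_borel: "steep_points F c \<in> sets borel"
proof -
  let ?O = "\<lambda>n. \<Union>{{u<..<v} | u v. v - u < 1 / real (Suc n) \<and> F v - F u > c * (v - u)}"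
  have "steep_points F c = (\<Inter>n. ?O n)"
  proof (intro equalityI subsetI)
    fix x assume x: "x \<in> steep_points F c"
    show "x \<in> (\<Inter>n. ?O n)"
    proof
      fix n :: nat
      have "1 / real (Suc n) > 0" by simp
      then obtain u v where "u < x \<and> x < v \<and> v - u < 1 / real (Suc n) \<and> F v - F u > c * (v - u)"
        using x unfolding steep_points_def by blast
      then show "x \<in> ?O n" by (intro UnionI[of "{u<..<v}"]) auto
    qed
  next
    fix x assume x: "x \<in> (\<Inter>n. ?O n)"
    show "x \<in> steep_points F c"
      unfolding steep_points_def
    proof (clarify)
      fix d :: real assume "d > 0"
      then obtain n where n: "1 / real (Suc n) < d" using nat_approx_posE by blast
      have "x \<in> ?O n" using x by blast
      then obtain u v where "v - u < 1 / real (Suc n)" "F v - F u > c * (v - u)" "x \<in> {u<..<v}"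
        by blast
      then show "\<exists>u v. u < x \<and> x < v \<and> v - u < d \<and> F v - F u > c * (v - u)"
        using n by (intro exI[of _ u] exI[of _ v]) auto
    qed
  qed
  moreover have "open (?O n)" for n by (intro open_Union) auto
  ultimately show ?thesis
    by (simp only:) (intro sets.countable_INT'', auto)
qed

lemma steep_pointsI:
  assumes F: "isCont F x" and freq: "frequently (\<lambda>y. (F y - F x) / (y - x) > c) (at x)"
  shows "x \<in> steep_points F c"
  unfolding steep_points_def
proof clarify
  fix d :: real assume "d > 0"
  have "eventually (\<lambda>y. dist y x < d / 2) (at x)"
    using eventually_at_ball[of "d/2" x UNIV] \<open>d > 0\<close> by (auto simp: dist_commute)
  moreover have "eventually (\<lambda>y. y \<noteq> x) (at x)" by (simp add: eventually_at_filter)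
  ultimately have "frequently (\<lambda>y. (F y - F x) / (y - x) > c \<and> dist y x < d / 2 \<and> y \<noteq> x) (at x)"
    by (intro frequently_rev_mp[OF freq], eventually_elim) auto
  then obtain y where y: "(F y - F x) / (y - x) > c" "dist y x < d / 2" "y \<noteq> x"
    by (auto dest: frequently_ex)
  consider "x < y" | "y < x" using y by linarith
  then show "\<exists>u v. u < x \<and> x < v \<and> v - u < d \<and> F v - F u > c * (v - u)"
  proof cases
    case 1
    have "((\<lambda>u. (F y - F u) - c * (y - u)) \<longlongrightarrow> (F y - F x) - c * (y - x)) (at_left x)"
      using F by (auto intro!: tendsto_intros simp: isCont_def elim: filterlim_mono simp: at_le)
    moreover have "(F y - F x) - c * (y - x) > 0" using y 1 by (simp add: field_simps)
    ultimately have "eventually (\<lambda>u. (F y - F u) - c * (y - u) > 0) (at_left x)"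
      by (rule order_tendstoD)
    moreover have "eventually (\<lambda>u. u \<in> {x - d / 2<..<x}) (at_left x)"
      using \<open>d > 0\<close> by (intro eventually_at_leftI) auto
    ultimately have "eventually (\<lambda>u. u < x \<and> x < y \<and> y - u < d \<and> F y - F u > c * (y - u)) (at_left x)"
      by eventually_elim (use 1 y in \<open>auto simp: dist_real_def\<close>)
    then show ?thesis
      using eventually_happens'[OF trivial_limit_at_left_real] by blast
  next
    case 2
    have "((\<lambda>v. (F v - F y) - c * (v - y)) \<longlongrightarrow> (F x - F y) - c * (x - y)) (at_right x)"
      using F by (auto intro!: tendsto_intros simp: isCont_def elim: filterlim_mono simp: at_le)
    moreover have "(F x - F y) - c * (x - y) > 0" using y 2 by (simp add: field_simps)
    ultimately have "eventually (\<lambda>v. (F v - F y) - c * (v - y) > 0) (at_right x)"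
      by (rule order_tendstoD)
    moreover have "eventually (\<lambda>v. v \<in> {x<..<x + d / 2}) (at_right x)"
      using \<open>d > 0\<close> by (intro eventually_at_rightI) auto
    ultimately have "eventually (\<lambda>v. y < x \<and> x < v \<and> v - y < d \<and> F v - F y > c * (v - y)) (at_right x)"
      by eventually_elim (use 2 y in \<open>auto simp: dist_real_def\<close>)
    then show ?thesis
      using eventually_happens'[OF trivial_limit_at_right_real] by blast
  qed
qed

text \<open>The difference quotient is eventually bounded, and its lower and upper limits cannot be separated
  by two rational numbers.\<close>

lemma differentiable_if_not_steep:
  fixes F :: "real \<Rightarrow> real"
  assumes F: "isCont F x"
    and above: "x \<notin> steep_points F M" and below: "x \<notin> steep_points (\<lambda>y. - F y) M'"
    and osc: "\<And>c d. \<lbrakk>c \<in> \<rat>; d \<in> \<rat>; c < d; x \<in> steep_points F d\<rbrakk> \<Longrightarrow> x \<notin> steep_points (\<lambda>y. - F y) (- c)"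
  shows "F differentiable (at x)"
proof -
  let ?q = "\<lambda>y. (F y - F x) / (y - x)"
  have Fm: "isCont (\<lambda>y. - F y) x" using F by simp
  have neg: "?q y < c \<longleftrightarrow> (- F y - - F x) / (y - x) > - c" for y c
  proof -
    have "(- F y - - F x) / (y - x) = - ?q y"
      by (metis minus_diff_minus minus_divide_left)
    then show ?thesis by linarith
  qed
  have up: "eventually (\<lambda>y. ?q y \<le> c) (at x)" if "x \<notin> steep_points F c" for c
    using steep_pointsI[OF F] that by (force simp: frequently_def not_less)
  have low: "eventually (\<lambda>y. ?q y \<ge> c) (at x)" if "x \<notin> steep_points (\<lambda>y. - F y) (- c)" for c
  proof -
    have "\<not> frequently (\<lambda>y. (- F y - - F x) / (y - x) > - c) (at x)"
      using steep_pointsI[OF Fm] that by blast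
    then show ?thesis
      unfolding frequently_def neg[symmetric] by (simp add: not_less)
  qed
  let ?L = "Limsup (at x) (\<lambda>y. ereal (?q y))" and ?l = "Liminf (at x) (\<lambda>y. ereal (?q y))"
  have "?L \<le> ereal M" using up[OF above] by (intro Limsup_bounded) simp
  moreover have "?l \<ge> ereal (- M')" using low[of "- M'"] below by (intro Liminf_bounded) simp
  moreover have lL: "?l \<le> ?L" by (intro Liminf_le_Limsup) simp
  ultimately obtain L l where Ll: "?L = ereal L" "?l = ereal l"
    by (cases ?L; cases ?l) auto
  have "l = L"
  proof (rule ccontr)
    assume "l \<noteq> L"
    with lL Ll have "l < L" by simp
    obtain c where c: "c \<in> \<rat>" "l < c" "c < L" using Rats_dense_in_real[OF \<open>l < L\<close>] by blast
    obtain d where d: "d \<in> \<rat>" "c < d" "d < L" using Rats_dense_in_real[OF c(3)] by blast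
    show False
    proof (cases "x \<in> steep_points F d")
      case True
      have "?l \<ge> ereal c" using low[OF osc[OF c(1) d(1,2) True]] by (intro Liminf_bounded) simp
      with Ll c show False by simp
    next
      case False
      have "?L \<le> ereal d" using up[OF False] by (intro Limsup_bounded) simp
      with Ll d show False by simp
    qed
  qed
  then have "((\<lambda>y. ereal (?q y)) \<longlongrightarrow> ereal L) (at x)"
    using Ll by (intro iffD2[OF tendsto_iff_Liminf_eq_Limsup]) auto
  then have "(?q \<longlongrightarrow> L) (at x)" by simp
  then have "(F has_real_derivative L) (at x)"
    by (simp add: has_field_derivative_iff)
  then show ?thesis by (auto simp: differentiable_def has_field_derivative_def)
qed

text \<open>If the set of points of infinite upper derivate had measure \<open>m > 0\<close> inside a short interval,
  a Vitali cover by intervals of slope above \<open>2 / m\<close> would have short total length, but increments adding up to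
  more than \<open>1\<close>.\<close>

lemma steep_everywhere_null:
  fixes F :: "real \<Rightarrow> real"
  assumes F: "ac_on_divisions F"
  shows "negligible (\<Inter>M\<in>\<nat>. steep_points F M)" (is "negligible ?S")
proof -
  obtain \<delta> where \<delta>: "\<delta> > 0"
    "\<And>D. \<lbrakk>D division_of \<Union>D; (\<Sum>K\<in>D. measure lborel K) < \<delta>\<rbrakk> \<Longrightarrow> (\<Sum>K\<in>D. norm (F (Sup K) - F (Inf K))) < 1"
    using ac_on_divisionsE[OF F, of 1] by auto
  have borel: "?S \<in> sets borel"
    by (intro sets.countable_INT'') (auto simp: steep_points_borel Nats_def)
  have loc: "negligible (?S \<inter> ball x (\<delta> / 4))" for x
  proof (rule ccontr)
    let ?T = "?S \<inter> ball x (\<delta> / 4)"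
    assume *: "\<not> negligible ?T"
    have T: "?T \<in> lmeasurable"
      by (rule fmeasurableI2[of "ball x (\<delta> / 4)"]) (use borel in auto)
    define m where "m = measure lebesgue ?T"
    have m: "m > 0" using * T by (metis m_def negligible_iff_measure zero_less_measure_iff)
    obtain M where M: "M \<in> \<nat>" "M \<ge> 2 / m"
      by (metis Nats_def of_nat_in_Nats real_arch_simple)
    obtain D where D: "D division_of \<Union>D" "\<Union>D \<subseteq> ball x (\<delta> / 4)"
      "\<And>K. K \<in> D \<Longrightarrow> F (Sup K) - F (Inf K) > M * (Sup K - Inf K)" "measure lebesgue (?T - \<Union>D) < m / 2"
    proof (rule Vitali_finite_cover_real[OF T _ _ , of "ball x (\<delta> / 4)" "m / 2" "\<lambda>u v. F v - F u > M * (v - u)"])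
      fix y d assume "y \<in> ?T" "(d::real) > 0"
      then have "y \<in> steep_points F M" using M by auto
      then show "\<exists>u v. u < y \<and> y < v \<and> v - u < d \<and> M * (v - u) < F v - F u"
        using \<open>d > 0\<close> unfolding steep_points_def by blast
    qed (use m in auto)
    note md = measure_Union_division[OF D(1)]
    have "measure lebesgue (\<Union>D) \<le> measure lebesgue (ball x (\<delta> / 4))"
      using D(2) md(1) by (intro measure_mono_fmeasurable) (auto simp: fmeasurableD)
    also have "\<dots> < \<delta>" using \<delta>(1) by (simp add: ball_eq_greaterThanLessThan measure_completion)
    finally have "(\<Sum>K\<in>D. norm (F (Sup K) - F (Inf K))) < 1"
      using D(1) md(2) by (intro \<delta>(2)) auto
    moreover have "(\<Sum>K\<in>D. norm (F (Sup K) - F (Inf K))) \<ge> M * measure lebesgue (\<Union>D)"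
      unfolding md(2) sum_distrib_left
    proof (rule sum_mono)
      fix K assume "K \<in> D"
      then show "M * measure lborel K \<le> norm (F (Sup K) - F (Inf K))"
        using D(3)[OF \<open>K \<in> D\<close>] division_interval_real(3)[OF D(1) \<open>K \<in> D\<close>] by simp
    qed
    moreover have "m \<le> measure lebesgue (?T - \<Union>D) + measure lebesgue (\<Union>D)"
    proof -
      have "m \<le> measure lebesgue ((?T - \<Union>D) \<union> \<Union>D)"
        unfolding m_def using T md(1)
        by (intro measure_mono_fmeasurable fmeasurable.Un fmeasurable.Diff) (auto simp: fmeasurableD)
      also have "\<dots> \<le> measure lebesgue (?T - \<Union>D) + measure lebesgue (\<Union>D)"
        using T md(1) by (intro measure_Un_le) (auto simp: fmeasurableD)
      finally show ?thesis .
    qed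
    moreover have "M * (m / 2) \<ge> 1" using M m by (simp add: field_simps)
    moreover have "M > 0" using M(2) m by (meson divide_pos_pos less_le_trans zero_less_numeral)
    ultimately show False
      using D(4) by (smt (verit) mult_less_cancel_left_pos field_sum_of_halves)
  qed
  show ?thesis
    unfolding locally_negligible_alt[of ?S]
  proof
    fix x assume "x \<in> ?S"
    then show "\<exists>U. openin (top_of_set ?S) U \<and> x \<in> U \<and> negligible U"
      using loc[of x] \<delta>(1) by (intro exI[of _ "?S \<inter> ball x (\<delta> / 4)"]) (auto intro: openin_open_Int)
  qed
qed

text \<open>If a bounded part \<open>T\<close> of the set has measure \<open>m > 0\<close>, cover it twice: first by intervals \<open>D\<close> on which the slope
  of the chord is above \<open>c\<close>, and then, inside these, by intervals \<open>E\<close> on which it is negative.  Both families have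
  total length close to \<open>m\<close>, so the gaps \<open>G\<close> left in \<open>D\<close> by \<open>E\<close> have small total length, and by absolute
  continuity the increments over the gaps are small.  The total increment over \<open>D\<close> is then at least
  about \<open>c * m\<close>, but it is also the sum of a negative number and a small one.\<close>

lemma steep_up_and_down_null:
  fixes F :: "real \<Rightarrow> real"
  assumes F: "ac_on_divisions F" and "c > 0"
  shows "negligible (steep_points F c \<inter> steep_points (\<lambda>x. - F x) 0)" (is "negligible ?S")
proof -
  have borel: "?S \<in> sets borel" by (intro sets.Int steep_points_borel)
  have loc: "negligible (?S \<inter> ball x 1)" for x
  proof (rule ccontr)
    let ?T = "?S \<inter> ball x 1"
    assume *: "\<not> negligible ?T"
    have T: "?T \<in> lmeasurable"
      by (rule fmeasurableI2[of "ball x 1"]) (use borel in auto)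
    define m where "m = measure lebesgue ?T"
    have m: "m > 0" using * T by (metis m_def negligible_iff_measure zero_less_measure_iff)
    have "c * m / 2 > 0" using m \<open>c > 0\<close> by simp
    then obtain \<delta> where \<delta>: "\<delta> > 0"
      "\<And>D. \<lbrakk>D division_of \<Union>D; (\<Sum>K\<in>D. measure lborel K) < \<delta>\<rbrakk> \<Longrightarrow>
         (\<Sum>K\<in>D. norm (F (Sup K) - F (Inf K))) < c * m / 2"
      using ac_on_divisionsE[OF F] by metis
    \<comment> \<open>The open set and the two covers each lose at most \<open>\<epsilon>\<close>, so the gaps have total length below \<open>3 * \<epsilon>\<close>.\<close>
    define \<epsilon> where "\<epsilon> = min (\<delta> / 4) (m / 2)"
    have \<epsilon>: "\<epsilon> > 0" "3 * \<epsilon> < \<delta>" "\<epsilon> \<le> m / 2" using m \<delta>(1) by (auto simp: \<epsilon>_def min_def)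
    obtain U where U: "open U" "?T \<subseteq> U" "U - ?T \<in> lmeasurable" "measure lebesgue (U - ?T) < \<epsilon>"
    proof -
      obtain U where U: "open U" "?T \<subseteq> U" "U - ?T \<in> lmeasurable" "emeasure lebesgue (U - ?T) < ennreal \<epsilon>"
        using sets_lebesgue_outer_open[of ?T \<epsilon>] T \<epsilon>(1) by (metis fmeasurableD)
      then have "measure lebesgue (U - ?T) < \<epsilon>"
        using \<epsilon>(1) by (simp add: emeasure_eq_measure2 ennreal_less_iff)
      with U that show thesis by blast
    qed
    have Ueq: "U = ?T \<union> (U - ?T)" using U by blast
    have Ulm: "U \<in> lmeasurable" using T U by (subst Ueq) (intro fmeasurable.Un)
    have Um: "measure lebesgue U < m + \<epsilon>"
    proof -
      have "measure lebesgue U \<le> measure lebesgue ?T + measure lebesgue (U - ?T)"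
        using T U by (subst Ueq, intro measure_Un_le) (auto simp: fmeasurableD)
      with U(4) show ?thesis by (simp add: m_def)
    qed
    obtain D where D: "D division_of \<Union>D" "pairwise disjnt D" "\<Union>D \<subseteq> U"
      "\<And>K. K \<in> D \<Longrightarrow> F (Sup K) - F (Inf K) > c * (Sup K - Inf K)" "measure lebesgue (?T - \<Union>D) < \<epsilon>"
    proof (rule Vitali_finite_cover_real[OF T U(1,2) \<epsilon>(1), of "\<lambda>u v. F v - F u > c * (v - u)"])
      fix y d assume "y \<in> ?T" "(d::real) > 0"
      then have "y \<in> steep_points F c" by auto
      then show "\<exists>u v. u < y \<and> y < v \<and> v - u < d \<and> c * (v - u) < F v - F u"
        using \<open>d > 0\<close> unfolding steep_points_def by blast
    qed auto
    let ?V = "\<Union>(interior ` D)"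
    have TV: "?T \<inter> ?V \<in> lmeasurable"
    proof (rule fmeasurableI2[OF T])
      have "open ?V" by auto
      then have "?V \<in> sets lebesgue" by (metis borel_open sets_completionI_sets sets_lborel)
      then show "?T \<inter> ?V \<in> sets lebesgue" by (rule sets.Int[OF fmeasurableD[OF T]])
    qed auto
    obtain E where E: "E division_of \<Union>E" "pairwise disjnt E" "\<Union>E \<subseteq> ?V"
      "\<And>K. K \<in> E \<Longrightarrow> F (Sup K) - F (Inf K) < 0 \<and> (\<exists>L\<in>D. {Inf K..Sup K} \<subseteq> L)"
      "measure lebesgue (?T \<inter> ?V - \<Union>E) < \<epsilon>"
    proof (rule Vitali_finite_cover_real[OF TV _ _ \<epsilon>(1), of ?V "\<lambda>u v. F v - F u < 0 \<and> (\<exists>L\<in>D. {u..v} \<subseteq> L)"])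
      fix y d assume y: "y \<in> ?T \<inter> ?V" and "(d::real) > 0"
      then obtain L where L: "L \<in> D" "y \<in> interior L" by auto
      then obtain d' where d': "d' > 0" "ball y d' \<subseteq> L"
        by (meson mem_interior)
      have "y \<in> steep_points (\<lambda>x. - F x) 0" using y by auto
      then obtain u v where uv: "u < y" "y < v" "v - u < min d d'" "0 * (v - u) < - F v - - F u"
        using \<open>d > 0\<close> d'(1) unfolding steep_points_def by (smt (verit) mem_Collect_eq)
      have "{u..v} \<subseteq> ball y d'" using uv by (auto simp: dist_real_def)
      then show "\<exists>u v. u < y \<and> y < v \<and> v - u < d \<and> F v - F u < 0 \<and> (\<exists>L\<in>D. {u..v} \<subseteq> L)"
        using uv d' L(1) by (intro exI[of _ u] exI[of _ v]) auto
    qed auto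
    note mD = measure_Union_division[OF D(1)] and mE = measure_Union_division[OF E(1)]
    have finD: "finite D" and finE: "finite E" using D E by blast+
    have mED: "m \<le> measure lebesgue (\<Union>D) + \<epsilon>"  "m \<le> measure lebesgue (\<Union>E) + 2 * \<epsilon>"
    proof -
      have "m \<le> measure lebesgue ((?T - \<Union>D) \<union> \<Union>D)"
        unfolding m_def using T mD(1)
        by (intro measure_mono_fmeasurable fmeasurable.Un fmeasurable.Diff) (auto simp: fmeasurableD)
      also have "\<dots> \<le> measure lebesgue (?T - \<Union>D) + measure lebesgue (\<Union>D)"
        using T mD(1) by (intro measure_Un_le) (auto simp: fmeasurableD)
      finally show "m \<le> measure lebesgue (\<Union>D) + \<epsilon>" using D(5) by simp
      \<comment> \<open>A point of \<open>T\<close> missed by the second cover is missed by the first, is an endpoint, or is lost in the interior.\<close>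
      have neg: "negligible (\<Union>(frontier ` D))"
        using finD division_ofD(4)[OF D(1)]
        by (intro negligible_Union) (auto intro!: negligible_convex_frontier dest!: division_ofD(4)[OF D(1)])
      have frlm: "\<Union>(frontier ` D) \<in> lmeasurable" using neg by (rule negligible_imp_measurable)
      let ?A = "?T - \<Union>D" and ?B = "?T \<inter> ?V - \<Union>E"
      have A: "?A \<in> lmeasurable" and B: "?B \<in> lmeasurable"
        using T mD(1) TV mE(1) by (auto intro!: fmeasurable.Diff)
      have "?T \<subseteq> ?A \<union> ?B \<union> \<Union>E \<union> \<Union>(frontier ` D)"
      proof
        fix y assume y: "y \<in> ?T"
        show "y \<in> ?A \<union> ?B \<union> \<Union>E \<union> \<Union>(frontier ` D)"
        proof (cases "y \<in> \<Union>D")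
          case True
          then obtain K where K: "K \<in> D" "y \<in> K" by blast
          then have "y \<in> interior K \<or> y \<in> frontier K"
            using closure_subset[of K] by (auto simp: frontier_def)
          then show ?thesis using K(1) y by blast
        qed (use y in blast)
      qed
      then have "m \<le> measure lebesgue (?A \<union> ?B \<union> \<Union>E \<union> \<Union>(frontier ` D))"
        unfolding m_def using T A B mE(1) frlm
        by (intro measure_mono_fmeasurable) (auto simp: fmeasurableD)
      also have "\<dots> \<le> measure lebesgue (?A \<union> ?B \<union> \<Union>E) + measure lebesgue (\<Union>(frontier ` D))"
        using A B mE(1) frlm by (intro measure_Un_le) (auto simp: fmeasurableD)
      also have "measure lebesgue (?A \<union> ?B \<union> \<Union>E) \<le> measure lebesgue (?A \<union> ?B) + measure lebesgue (\<Union>E)"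
        using A B mE(1) by (intro measure_Un_le) (auto simp: fmeasurableD)
      also have "measure lebesgue (?A \<union> ?B) \<le> measure lebesgue ?A + measure lebesgue ?B"
        using A B by (intro measure_Un_le) (auto simp: fmeasurableD)
      also have "measure lebesgue (\<Union>(frontier ` D)) = 0"
        using neg by (rule negligible_imp_measure0)
      finally show "m \<le> measure lebesgue (\<Union>E) + 2 * \<epsilon>" using D(5) E(5) by simp
    qed
    \<comment> \<open>The intervals of the second cover inside \<open>L\<close> extend to a division of \<open>L\<close>; the added intervals are the gaps.\<close>
    define EL where "EL L = {K \<in> E. K \<subseteq> L}" for L
    have EL: "EL L division_of \<Union>(EL L)" for L
      using E(1) by (rule division_of_subset) (auto simp: EL_def)
    have "\<exists>R. EL L \<subseteq> R \<and> R division_of L" if L: "L \<in> D" for L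
    proof -
      obtain a b where "L = cbox a b" using division_ofD(4)[OF D(1) L] by blast
      then show ?thesis
        using partial_division_extend_interval[OF EL[of L], of a b] by (metis (no_types, lifting) EL_def Sup_least mem_Collect_eq)
    qed
    then obtain R where R: "\<And>L. L \<in> D \<Longrightarrow> EL L \<subseteq> R L" "\<And>L. L \<in> D \<Longrightarrow> R L division_of L"
      by metis
    define G where "G = (\<Union>L\<in>D. R L - EL L)"
    have subL: "K \<subseteq> L" if "L \<in> D" "K \<in> R L" for K L
      using R(2)[OF that(1)] that(2) by (rule division_ofD(2))
    have ne: "K \<noteq> {}" if "L \<in> D" "K \<in> R L" for K L
      using R(2)[OF that(1)] that(2) by (rule division_ofD(3))
    have G: "G division_of \<Union>G"
    proof (rule division_ofI)
      show "finite G" using finD R(2) by (auto simp: G_def)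
      fix K assume "K \<in> G"
      then obtain L where L: "L \<in> D" "K \<in> R L" by (auto simp: G_def)
      show "K \<subseteq> \<Union>G" using \<open>K \<in> G\<close> by blast
      show "K \<noteq> {}" using L by (rule ne)
      show "\<exists>a b. K = cbox a b" using R(2)[OF L(1)] L(2) by (rule division_ofD(4))
      fix K' assume "K' \<in> G" "K \<noteq> K'"
      then obtain L' where L': "L' \<in> D" "K' \<in> R L'" by (auto simp: G_def)
      show "interior K \<inter> interior K' = {}"
      proof (cases "L = L'")
        case True
        then show ?thesis using R(2)[OF L(1)] L(2) L'(2) \<open>K \<noteq> K'\<close> by (auto dest: division_ofD(5))
      next
        case False
        then have "interior L \<inter> interior L' = {}" using D(1) L(1) L'(1) by (auto dest: division_ofD(5))
        then show ?thesis using subL[OF L] subL[OF L'] by (meson disjoint_iff interior_mono subsetD)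
      qed
    qed auto
    \<comment> \<open>Used below for \<open>F\<close> and, with \<open>H\<close> the identity, for lengths.\<close>
    have split: "(\<Sum>L\<in>D. H (Sup L) - H (Inf L)) = (\<Sum>K\<in>E. H (Sup K) - H (Inf K)) + (\<Sum>K\<in>G. H (Sup K) - H (Inf K))"
      for H :: "real \<Rightarrow> real"
    proof -
      let ?h = "\<lambda>K. H (Sup K) - H (Inf K)"
      have disjD: "L \<inter> L' = {}" if "L \<in> D" "L' \<in> D" "L \<noteq> L'" for L L'
        using D(2) that by (auto simp: pairwise_def disjnt_def)
      have "(\<Sum>L\<in>D. ?h L) = (\<Sum>L\<in>D. sum ?h (EL L) + sum ?h (R L - EL L))"
      proof (rule sum.cong[OF refl])
        fix L assume L: "L \<in> D"
        note iv = division_interval_real[OF D(1) L]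
        have "sum ?h (R L) = ?h L"
        proof (rule additive_division_real)
          show "R L division_of {Inf L..Sup L}" using R(2)[OF L] iv(2) by metis
        qed (fact iv(1))
        moreover have "sum ?h (R L) = sum ?h (EL L) + sum ?h (R L - EL L)"
          using sum.subset_diff[OF R(1)[OF L] division_of_finite[OF R(2)[OF L]], of ?h]
          by (simp only: add.commute)
        ultimately show "?h L = sum ?h (EL L) + sum ?h (R L - EL L)" by simp
      qed
      also have "\<dots> = (\<Sum>L\<in>D. sum ?h (EL L)) + (\<Sum>L\<in>D. sum ?h (R L - EL L))"
        by (rule sum.distrib)
      also have "(\<Sum>L\<in>D. sum ?h (EL L)) = sum ?h (\<Union>L\<in>D. EL L)"
      proof (rule sum.UNION_disjoint[symmetric, OF finD])
        show "\<forall>L\<in>D. finite (EL L)" using finE by (auto simp: EL_def)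
        show "\<forall>L\<in>D. \<forall>L'\<in>D. L \<noteq> L' \<longrightarrow> EL L \<inter> EL L' = {}"
        proof (intro ballI impI)
          fix L L' assume L: "L \<in> D" "L' \<in> D" "L \<noteq> L'"
          have "K = {}" if "K \<in> EL L" "K \<in> EL L'" for K
            using that disjD[OF L] by (auto simp: EL_def)
          moreover have "K \<noteq> {}" if "K \<in> EL L" for K
            using that division_ofD(3)[OF E(1)] by (auto simp: EL_def)
          ultimately show "EL L \<inter> EL L' = {}" by blast
        qed
      qed
      also have "(\<Union>L\<in>D. EL L) = E"
      proof -
        have "\<exists>L\<in>D. K \<subseteq> L" if "K \<in> E" for K
          using E(4)[OF that] division_interval_real(2)[OF E(1) that] by metis
        then show ?thesis by (auto simp: EL_def)
      qed
      also have "(\<Sum>L\<in>D. sum ?h (R L - EL L)) = sum ?h G"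
        unfolding G_def
      proof (rule sum.UNION_disjoint[symmetric, OF finD])
        show "\<forall>L\<in>D. finite (R L - EL L)" using R(2) by auto
        show "\<forall>L\<in>D. \<forall>L'\<in>D. L \<noteq> L' \<longrightarrow> (R L - EL L) \<inter> (R L' - EL L') = {}"
        proof (intro ballI impI)
          fix L L' assume L: "L \<in> D" "L' \<in> D" "L \<noteq> L'"
          have False if "K \<in> R L" "K \<in> R L'" for K
            using subL[OF L(1) that(1)] subL[OF L(2) that(2)] ne[OF L(1) that(1)] disjD[OF L] by blast
          then show "(R L - EL L) \<inter> (R L' - EL L') = {}" by blast
        qed
      qed
      finally show ?thesis .
    qed
    have len: "(\<Sum>K\<in>Q. measure lborel K) = (\<Sum>K\<in>Q. Sup K - Inf K)" if "Q division_of \<Union>Q" for Q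
      using division_interval_real(3)[OF that] by (rule sum.cong[OF refl])
    have "(\<Sum>K\<in>G. measure lborel K) = measure lebesgue (\<Union>D) - measure lebesgue (\<Union>E)"
      using split[of "\<lambda>x. x"] by (simp add: mD(2) mE(2) len D(1) E(1) G)
    also have "measure lebesgue (\<Union>D) \<le> measure lebesgue U"
      using D(3) mD(1) Ulm by (intro measure_mono_fmeasurable) (auto simp: fmeasurableD)
    finally have "(\<Sum>K\<in>G. measure lborel K) < \<delta>"
      using Um mED(2) \<epsilon>(2) by simp
    then have "(\<Sum>K\<in>G. norm (F (Sup K) - F (Inf K))) < c * m / 2"
      using G by (intro \<delta>(2))
    moreover have "(\<Sum>K\<in>G. F (Sup K) - F (Inf K)) \<le> (\<Sum>K\<in>G. norm (F (Sup K) - F (Inf K)))"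
      by (intro sum_mono) auto
    moreover have "(\<Sum>K\<in>E. F (Sup K) - F (Inf K)) \<le> 0"
      using E(4) by (intro sum_nonpos) (simp add: less_imp_le)
    moreover have "c * measure lebesgue (\<Union>D) \<le> (\<Sum>K\<in>D. F (Sup K) - F (Inf K))"
      unfolding mD(2) len[OF D(1)] sum_distrib_left
      using D(4) by (intro sum_mono) (auto intro: less_imp_le)
    moreover have "c * (m / 2) \<le> c * measure lebesgue (\<Union>D)"
      using mED(1) \<epsilon>(3) \<open>c > 0\<close> by simp
    ultimately show False
      using split[of F] by simp
  qed
  show ?thesis
    unfolding locally_negligible_alt[of ?S]
  proof
    fix x assume "x \<in> ?S"
    then show "\<exists>U. openin (top_of_set ?S) U \<and> x \<in> U \<and> negligible U"
      using loc[of x] by (intro exI[of _ "?S \<inter> ball x 1"]) (auto intro: openin_open_Int)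
  qed
qed

text \<open>Two rationals \<open>c < d\<close> separating the derivates reduce to the slopes \<open>0\<close> and \<open>d - c\<close> of
  the absolutely continuous function \<open>F x - c * x\<close>.\<close>

lemma ac_real_differentiable_ae:
  fixes F :: "real \<Rightarrow> real"
  assumes F: "ac_on_divisions F"
  shows "negligible {x. \<not> F differentiable (at x)}"
proof -
  have mF: "ac_on_divisions (\<lambda>x. - F x)"
    using F by (rule ac_on_divisions_bound[where c = 1]) (auto simp: norm_minus_commute)
  let ?N = "(\<Inter>M\<in>\<nat>. steep_points F M) \<union> (\<Inter>M\<in>\<nat>. steep_points (\<lambda>x. - F x) M) \<union>
    (\<Union>(c, d)\<in>{(c, d) \<in> \<rat> \<times> \<rat>. c < d}. steep_points F d \<inter> steep_points (\<lambda>x. - F x) (- c))"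
  have "negligible (steep_points F d \<inter> steep_points (\<lambda>x. - F x) (- c))" if "c < d" for c d
  proof -
    have 1: "steep_points (\<lambda>x. F x - c * x) (d - c) = steep_points F d"
      by (auto simp: steep_points_def algebra_simps)
    have 2: "steep_points (\<lambda>x. - (F x - c * x)) 0 = steep_points (\<lambda>x. - F x) (- c)"
      by (auto simp: steep_points_def algebra_simps)
    show ?thesis
      using steep_up_and_down_null[OF ac_on_divisions_subtract_linear[OF F, of c], of "d - c"] that
      unfolding 1 2 by simp
  qed
  moreover have "countable {(c, d) \<in> \<rat> \<times> \<rat>. c < (d::real)}"
    by (rule countable_subset[OF _ countable_SIGMA[OF countable_rat countable_rat]]) auto
  ultimately have "negligible ?N"
    by (intro negligible_Un steep_everywhere_null F mF negligible_countable_Union countable_image) auto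
  moreover have "{x. \<not> F differentiable (at x)} \<subseteq> ?N"
  proof (intro subsetI, rule ccontr)
    fix x assume nd: "x \<in> {x. \<not> F differentiable (at x)}" and N: "x \<notin> ?N"
    then obtain M M' where M: "x \<notin> steep_points F M" "x \<notin> steep_points (\<lambda>x. - F x) M'" by blast
    have "F differentiable (at x)"
      by (rule differentiable_if_not_steep[OF ac_on_divisions_isCont[OF F] M]) (use N in blast)
    with nd show False by simp
  qed
  ultimately show ?thesis by (rule negligible_subset)
qed

lemma ac_complex_differentiable_ae:
  fixes f :: "real \<Rightarrow> complex"
  assumes f: "ac_on_divisions f"
  shows "negligible {x. \<not> f differentiable (at x)}"
proof -
  have "\<bar>Re z - Re w\<bar> \<le> cmod (z - w)" "\<bar>Im z - Im w\<bar> \<le> cmod (z - w)" for z w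
    using abs_Re_le_cmod[of "z - w"] abs_Im_le_cmod[of "z - w"] by simp_all
  then have "ac_on_divisions (\<lambda>x. Re (f x))" "ac_on_divisions (\<lambda>x. Im (f x))"
    by (simp_all add: ac_on_divisions_bound[OF f, of 1])
  then have "negligible ({x. \<not> (\<lambda>x. Re (f x)) differentiable (at x)} \<union> {x. \<not> (\<lambda>x. Im (f x)) differentiable (at x)})"
    by (intro negligible_Un ac_real_differentiable_ae)
  moreover have "{x. \<not> f differentiable (at x)} \<subseteq>
    {x. \<not> (\<lambda>x. Re (f x)) differentiable (at x)} \<union> {x. \<not> (\<lambda>x. Im (f x)) differentiable (at x)}"
  proof (intro subsetI, rule ccontr)
    fix x assume "x \<in> {x. \<not> f differentiable (at x)}"
      and "x \<notin> {x. \<not> (\<lambda>x. Re (f x)) differentiable (at x)} \<union> {x. \<not> (\<lambda>x. Im (f x)) differentiable (at x)}"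
    then have *: "(\<lambda>x. Re (f x)) differentiable (at x)" "(\<lambda>x. Im (f x)) differentiable (at x)"
      and nd: "\<not> f differentiable (at x)" by auto
    from *(1) obtain a where a: "((\<lambda>x. Re (f x)) has_vector_derivative a) (at x)"
      using vector_derivative_works by blast
    from *(2) obtain b where b: "((\<lambda>x. Im (f x)) has_vector_derivative b) (at x)"
      using vector_derivative_works by blast
    have "(f has_vector_derivative Complex a b) (at x)"
      unfolding has_vector_derivative_complex_iff using a b
      by (simp add: has_real_derivative_iff_has_vector_derivative)
    then show False using nd by (auto simp: differentiable_def has_vector_derivative_def)
  qed
  ultimately show ?thesis by (rule negligible_subset)
qed

text \<open>The gauge controls the increments at tags outside \<open>N\<close> by differentiability; tags in \<open>N\<close>, where \<open>h\<close> is replaced by \<open>0\<close>,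
  are forced into an open set of small measure, and the increments over their intervals are small by
  absolute continuity.\<close>

theorem ac_fundamental_theorem:
  fixes f :: "real \<Rightarrow> 'a::euclidean_space"
  assumes f: "ac_on_divisions f" and "a \<le> b" and N: "negligible N"
    and der: "\<And>x. x \<notin> N \<Longrightarrow> (f has_vector_derivative h x) (at x)"
  shows "(h has_integral (f b - f a)) {a..b}"
proof -
  define h0 where "h0 x = (if x \<in> N then 0 else h x)" for x
  have "(h0 has_integral (f b - f a)) {a..b}"
    unfolding has_integral_real
  proof (intro allI impI)
    fix e :: real assume e: "e > 0"
    define \<epsilon> where "\<epsilon> = e / (4 * (b - a + 1))"
    have \<epsilon>: "\<epsilon> > 0" using e \<open>a \<le> b\<close> by (simp add: \<epsilon>_def)
    have "e / 2 > 0" using e by simp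
    with f obtain \<delta> where \<delta>: "\<delta> > 0"
      "\<And>D. \<lbrakk>D division_of \<Union>D; (\<Sum>K\<in>D. measure lborel K) < \<delta>\<rbrakk> \<Longrightarrow>
         (\<Sum>K\<in>D. norm (f (Sup K) - f (Inf K))) < e / 2"
      using ac_on_divisionsE by metis
    have "N \<in> sets lebesgue" using N negligible_imp_sets by blast
    then obtain U where U: "open U" "N \<subseteq> U" "U - N \<in> lmeasurable" "emeasure lebesgue (U - N) < ennreal \<delta>"
      using sets_lebesgue_outer_open \<delta>(1) by metis
    have "U = (U - N) \<union> N" using U by blast
    then have Ulm: "U \<in> lmeasurable" 
      using U(3) negligible_imp_measurable[OF N] by (metis fmeasurable.Un)
    have "measure lebesgue U = measure lebesgue (U - N)"
      by (rule measure_negligible_symdiff[OF U(3)], rule negligible_subset[OF N]) auto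
    then have Um: "measure lebesgue U < \<delta>"
      using U(3,4) \<delta>(1) by (simp add: emeasure_eq_measure2 ennreal_less_iff)
    have "\<exists>d>0. (x \<in> N \<longrightarrow> ball x d \<subseteq> U) \<and>
       (x \<notin> N \<longrightarrow> (\<forall>y. norm (y - x) < d \<longrightarrow> norm (f y - f x - (y - x) *\<^sub>R h0 x) \<le> \<epsilon> * norm (y - x)))" for x
    proof (cases "x \<in> N")
      case True
      then show ?thesis using U by (auto dest: openE)
    next
      case False
      then have "(f has_vector_derivative h0 x) (at x)" using der by (simp add: h0_def)
      then show ?thesis using False \<epsilon>
        unfolding has_vector_derivative_def has_derivative_within_alt by auto
    qed
    then obtain d where d: "\<And>x. d x > 0" "\<And>x. x \<in> N \<Longrightarrow> ball x (d x) \<subseteq> U"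
      "\<And>x y. x \<notin> N \<Longrightarrow> norm (y - x) < d x \<Longrightarrow> norm (f y - f x - (y - x) *\<^sub>R h0 x) \<le> \<epsilon> * norm (y - x)"
      by metis
    show "\<exists>\<gamma>. gauge \<gamma> \<and> (\<forall>p. p tagged_division_of {a..b} \<and> \<gamma> fine p \<longrightarrow>
        norm ((\<Sum>(x, K)\<in>p. measure lborel K *\<^sub>R h0 x) - (f b - f a)) < e)"
    proof (intro exI conjI allI impI)
      show "gauge (\<lambda>x. ball x (d x))" using d(1) gauge_ball_dependent by blast
    next
      fix p assume p: "p tagged_division_of {a..b} \<and> (\<lambda>x. ball x (d x)) fine p"
      then have ptag: "p tagged_division_of {a..b}" and fine: "(\<lambda>x. ball x (d x)) fine p" by auto
      have finp: "finite p" using ptag by blast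
      define g where "g = (\<lambda>(x, K). measure lborel K *\<^sub>R h0 x - (f (Sup K) - f (Inf K)))"
      have "(\<Sum>(x, K)\<in>p. measure lborel K *\<^sub>R h0 x) - (f b - f a) = sum g p"
        using additive_tagged_division_1[OF \<open>a \<le> b\<close> ptag, of f]
        by (simp add: g_def split_def sum_subtractf)
      also have "\<dots> = sum g {xK \<in> p. fst xK \<in> N} + sum g {xK \<in> p. fst xK \<notin> N}"
        using finp by (subst sum.union_disjoint[symmetric]) (auto intro!: sum.cong)
      finally have eq: "(\<Sum>(x, K)\<in>p. measure lborel K *\<^sub>R h0 x) - (f b - f a) =
        sum g {xK \<in> p. fst xK \<in> N} + sum g {xK \<in> p. fst xK \<notin> N}" .
      let ?q = "{xK \<in> p. fst xK \<in> N}"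
      have K: "\<exists>u v. K = {u..v} \<and> u \<le> v \<and> x \<in> K \<and> K \<subseteq> {a..b} \<and> K \<subseteq> ball x (d x)" if xK: "(x, K) \<in> p" for x K
      proof -
        have "x \<in> K" "K \<subseteq> {a..b}" using ptag xK by blast+
        moreover have "K \<subseteq> ball x (d x)" using fine xK by blast
        moreover obtain u v where "K = {u..v}" using ptag xK by (metis box_real(2) tagged_division_ofD(4))
        ultimately show ?thesis by (intro exI[of _ u] exI[of _ v]) auto
      qed
      have Kne: "K \<noteq> {}" if "(x, K) \<in> p" for x K
        using K[OF that] by blast
      have "norm (sum g ?q) \<le> (\<Sum>(x, K)\<in>?q. norm (f (Sup K) - f (Inf K)))"
      proof (rule sum_norm_le, clarify)
        fix x and K :: "real set" assume "fst (x, K) \<in> N"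
        then show "norm (g (x, K)) \<le> norm (f (Sup K) - f (Inf K))"
          by (simp add: g_def h0_def norm_minus_commute)
      qed
      also have "\<dots> < e / 2"
      proof -
        have "?q tagged_partial_division_of {a..b}"
          by (rule tagged_partial_division_subset[OF conjunct1[OF ptag[unfolded tagged_division_of_def]]]) blast
        then have qtag: "?q tagged_division_of \<Union>(snd ` ?q)"
          by (rule tagged_partial_division_of_Union_self)
        then have qdiv: "snd ` ?q division_of \<Union>(snd ` ?q)"
          by (rule division_of_tagged_division)
        let ?d = "\<lambda>K. if K = {} then 0 else norm (f (Sup K) - f (Inf K))"
        have "(\<Sum>(x, K)\<in>?q. norm (f (Sup K) - f (Inf K))) = (\<Sum>(x, K)\<in>?q. ?d K)"
          by (intro sum.cong) (auto dest: Kne)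
        also have "\<dots> = (\<Sum>K\<in>snd ` ?q. ?d K)"
        proof (rule sum.over_tagged_division_lemma[OF qtag])
          fix u v :: real assume "box u v = {}"
          then have "u = v \<or> cbox u v = {}" by auto
          then show "?d (cbox u v) = 0" by auto
        qed
        also have "\<dots> = (\<Sum>K\<in>snd ` ?q. norm (f (Sup K) - f (Inf K)))"
          by (intro sum.cong) (auto dest: Kne)
        also have "\<dots> < e / 2"
        proof (rule \<delta>(2)[OF qdiv])
          have "(\<Sum>K\<in>snd ` ?q. measure lborel K) = measure lebesgue (\<Union>(snd ` ?q))"
            using measure_Union_division(2)[OF qdiv] by simp
          also have "\<dots> \<le> measure lebesgue U"
          proof (rule measure_mono_fmeasurable)
            show "\<Union>(snd ` ?q) \<subseteq> U"
            proof (rule Union_least)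
              fix L assume "L \<in> snd ` ?q"
              then obtain x where x: "(x, L) \<in> p" "x \<in> N" by force
              then show "L \<subseteq> U" using K[OF x(1)] d(2)[OF x(2)] by blast
            qed
            show "\<Union>(snd ` ?q) \<in> sets lebesgue" using measure_Union_division(1)[OF qdiv] by (rule fmeasurableD)
          qed (fact Ulm)
          finally show "(\<Sum>K\<in>snd ` ?q. measure lborel K) < \<delta>" using Um by simp
        qed
        finally show ?thesis .
      qed
      finally have I: "norm (sum g ?q) < e / 2" .
      let ?r = "{xK \<in> p. fst xK \<notin> N}"
      have "norm (sum g ?r) \<le> (\<Sum>(x, K)\<in>?r. \<epsilon> * (Sup K - Inf K))"
      proof (rule sum_norm_le, clarify)
        fix x K assume xK: "(x, K) \<in> p" "fst (x, K) \<notin> N"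
        obtain u v where uv: "K = {u..v}" "u \<le> v" "x \<in> K" "K \<subseteq> ball x (d x)" using K[OF xK(1)] by blast
        have "u \<in> K" "v \<in> K" using uv by auto
        then have "u \<in> ball x (d x)" "v \<in> ball x (d x)" using uv(4) by blast+
        then have "norm (u - x) < d x" "norm (v - x) < d x" by (auto simp: dist_real_def)
        note d(3)[OF _ this(1)] d(3)[OF _ this(2)]
        then have "norm (f u - f x - (u - x) *\<^sub>R h0 x) \<le> \<epsilon> * norm (u - x)"
          "norm (f v - f x - (v - x) *\<^sub>R h0 x) \<le> \<epsilon> * norm (v - x)"
          using xK(2) by auto
        moreover have "norm ((v - u) *\<^sub>R h0 x - (f v - f u))
            = norm ((f u - f x - (u - x) *\<^sub>R h0 x) - (f v - f x - (v - x) *\<^sub>R h0 x))"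
          by (auto simp: algebra_simps)
        moreover have "\<epsilon> * norm (u - x) + \<epsilon> * norm (v - x) = \<epsilon> * (v - u)"
          using uv by (auto simp: algebra_simps)
        ultimately show "norm (g (x, K)) \<le> \<epsilon> * (Sup K - Inf K)"
          using uv norm_triangle_ineq4[of "f u - f x - (u - x) *\<^sub>R h0 x" "f v - f x - (v - x) *\<^sub>R h0 x"]
          by (simp add: g_def)
      qed
      also have "\<dots> \<le> (\<Sum>(x, K)\<in>p. \<epsilon> * (Sup K - Inf K))"
      proof (rule sum_mono2[OF finp])
        fix xK assume "xK \<in> p - ?r"
        then obtain x K where xK: "xK = (x, K)" "(x, K) \<in> p" by (cases xK) auto
        obtain u v where "K = {u..v}" "u \<le> v" using K[OF xK(2)] by blast
        then show "0 \<le> (case xK of (x, K) \<Rightarrow> \<epsilon> * (Sup K - Inf K))" using \<epsilon> by (simp add: xK(1))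
      qed auto
      also have "\<dots> = \<epsilon> * (b - a)"
        using additive_tagged_division_1[OF \<open>a \<le> b\<close> ptag, of "\<lambda>x. x"]
        by (simp add: split_def flip: sum_distrib_left)
      also have "\<dots> < e / 2"
      proof -
        have "\<epsilon> * (b - a) \<le> \<epsilon> * (b - a + 1)" using \<epsilon> by simp
        also have "\<dots> = e / 4" using \<open>a \<le> b\<close> by (simp add: \<epsilon>_def field_simps)
        also have "\<dots> < e / 2" using e by simp
        finally show ?thesis .
      qed
      finally have II: "norm (sum g ?r) < e / 2" .
      show "norm ((\<Sum>(x, K)\<in>p. measure lborel K *\<^sub>R h0 x) - (f b - f a)) < e"
        unfolding eq using I II norm_triangle_ineq[of "sum g ?q" "sum g ?r"] by linarith
    qed
  qed
  then show ?thesis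
    by (rule has_integral_spike[OF N, rotated]) (simp add: h0_def)
qed

section \<open>Averages over intervals\<close>

text \<open>Jensen's inequality for \<open>\<lambda>a. a powr q\<close>, in a form that covers the case of an infinite mean: it is enough to
  integrate the tangent line of the convex function at \<open>c\<close>.\<close>

lemma (in prob_space) powr_le_nn_integral_powr:
  fixes f :: "'a \<Rightarrow> real"
  assumes [measurable]: "f \<in> borel_measurable M" and f: "\<And>x. 0 \<le> f x" and q: "q \<ge> 1" and c: "c \<ge> 0"
    and le: "ennreal c \<le> (\<integral>\<^sup>+x. ennreal (f x) \<partial>M)"
  shows "ennreal (c powr q) \<le> (\<integral>\<^sup>+x. ennreal (f x powr q) \<partial>M)"
proof (cases "c = 0")
  case False
  with c have c: "c > 0" by simp
  \<comment> \<open>The graph lies above its tangent at \<open>c\<close>; this is Young's inequality for \<open>f x powr q\<close> and \<open>c powr q\<close>.\<close>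
  have young: "q * c powr (q - 1) * f x \<le> f x powr q + (q - 1) * c powr q" for x
  proof (cases "f x = 0")
    case False
    with f[of x] have "f x > 0" by simp
    then have "(f x powr q) powr (1 / q) * (c powr q) powr (1 - 1 / q) \<le> (1 / q) * f x powr q + (1 - 1 / q) * c powr q"
      using q c by (intro Youngs_inequality_0) auto
    moreover have "(f x powr q) powr (1 / q) = f x" using q \<open>f x > 0\<close> by (simp add: powr_powr)
    moreover have "(c powr q) powr (1 - 1 / q) = c powr (q - 1)"
      using q c by (simp add: powr_powr right_diff_distrib)
    ultimately have "q * (f x * c powr (q - 1)) \<le> q * ((1 / q) * f x powr q + (1 - 1 / q) * c powr q)"
      using q by (intro mult_left_mono) auto
    also have "\<dots> = f x powr q + (q - 1) * c powr q" using q by (simp add: field_simps)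
    finally show ?thesis by (simp add: mult_ac)
  qed (use q c in simp)
  have cq: "q * c powr (q - 1) * c = c powr q + (q - 1) * c powr q"
    using c q by (simp add: powr_mult_base powr_diff algebra_simps)
  have "ennreal (c powr q) + ennreal ((q - 1) * c powr q) = ennreal (q * c powr (q - 1)) * ennreal c"
    using q c by (simp add: cq flip: ennreal_plus ennreal_mult')
  also have "\<dots> \<le> ennreal (q * c powr (q - 1)) * (\<integral>\<^sup>+x. ennreal (f x) \<partial>M)"
    by (intro mult_left_mono le) auto
  also have "\<dots> = (\<integral>\<^sup>+x. ennreal (q * c powr (q - 1) * f x) \<partial>M)"
    using q f by (subst nn_integral_cmult[symmetric]) (auto simp: ennreal_mult')
  also have "\<dots> \<le> (\<integral>\<^sup>+x. ennreal (f x powr q) + ennreal ((q - 1) * c powr q) \<partial>M)"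
    using q by (intro nn_integral_mono) (simp add: young flip: ennreal_plus)
  also have "\<dots> = (\<integral>\<^sup>+x. ennreal (f x powr q) \<partial>M) + ennreal ((q - 1) * c powr q)"
    by (subst nn_integral_add) (auto simp: emeasure_space_1)
  finally show ?thesis by (simp add: ennreal_add_left_cancel_le add.commute[of _ "ennreal ((q - 1) * c powr q)"])
qed simp

text \<open>The mean of \<open>w\<close> over the interval of radius \<open>t\<close> about \<open>x\<close>, written as an expectation over a
  fixed probability space so that Jensen's inequality and joint measurability in \<open>t\<close> and \<open>x\<close>
  come for free.\<close>

definition avg :: "real \<Rightarrow> (real \<Rightarrow> ennreal) \<Rightarrow> real \<Rightarrow> ennreal" where
  "avg t w x = (\<integral>\<^sup>+s. w (x + t * s) \<partial>uniform_measure lborel {-1..1})"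

interpretation unif: prob_space "uniform_measure lborel {-1..1::real}"
  by (rule prob_space_uniform_measure) auto

lemma measurable_avg [measurable (raw)]:
  assumes [measurable]: "w \<in> borel_measurable borel" "f \<in> borel_measurable M" "g \<in> borel_measurable M"
  shows "(\<lambda>x. avg (f x) w (g x)) \<in> borel_measurable M"
  unfolding avg_def by measurable

lemma avg_mono_near: "(\<And>y. \<bar>x - y\<bar> \<le> \<bar>t\<bar> \<Longrightarrow> v y \<le> w y) \<Longrightarrow> avg t v x \<le> avg t w x"
  unfolding avg_def
  by (intro nn_integral_mono_AE AE_uniform_measureI) (auto simp: abs_mult mult_left_le)

lemma avg_mono: "(\<And>y. v y \<le> w y) \<Longrightarrow> avg t v x \<le> avg t w x"
  by (rule avg_mono_near)

lemma avg_add: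
  assumes [measurable]: "v \<in> borel_measurable borel" "w \<in> borel_measurable borel"
  shows "avg t (\<lambda>y. v y + w y) x = avg t v x + avg t w x"
  unfolding avg_def by (rule nn_integral_add) measurable

lemma avg_cmult:
  assumes [measurable]: "w \<in> borel_measurable borel"
  shows "avg t (\<lambda>y. c * w y) x = c * avg t w x"
  unfolding avg_def by (rule nn_integral_cmult) measurable

lemma avg_const: "avg t (\<lambda>y. c) x = c"
  unfolding avg_def by (simp add: unif.emeasure_space_1[simplified])

text \<open>By Tonelli and translation invariance.\<close>

lemma nn_integral_avg:
  assumes [measurable]: "w \<in> borel_measurable borel"
  shows "(\<integral>\<^sup>+x. avg t w x \<partial>lborel) = (\<integral>\<^sup>+x. w x \<partial>lborel)"
proof -
  interpret pair_sigma_finite lborel "uniform_measure lborel {-1..1::real}" ..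
  have "(\<integral>\<^sup>+x. avg t w x \<partial>lborel) = (\<integral>\<^sup>+s. (\<integral>\<^sup>+x. w (x + t * s) \<partial>lborel) \<partial>uniform_measure lborel {-1..1})"
    unfolding avg_def by (rule Fubini'[symmetric]) measurable
  also have "\<dots> = (\<integral>\<^sup>+s. (\<integral>\<^sup>+x. w x \<partial>lborel) \<partial>uniform_measure lborel {-1..1::real})"
  proof (rule nn_integral_cong)
    fix s
    show "(\<integral>\<^sup>+x. w (x + t * s) \<partial>lborel) = (\<integral>\<^sup>+x. w x \<partial>lborel)"
      using nn_integral_real_affine[of w 1 "t * s"] by (simp add: add.commute)
  qed
  finally show ?thesis by (simp add: unif.emeasure_space_1[simplified])
qed

lemma avg_eq_interval:
  assumes [measurable]: "w \<in> borel_measurable borel" and t: "t > 0"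
  shows "ennreal (2 * t) * avg t w x = (\<integral>\<^sup>+y. w y * indicator {x - t..x + t} y \<partial>lborel)"
proof -
  have "(\<integral>\<^sup>+y. w y * indicator {x - t..x + t} y \<partial>lborel)
      = ennreal t * (\<integral>\<^sup>+s. w (x + t * s) * indicator {x - t..x + t} (x + t * s) \<partial>lborel)"
    using t by (subst nn_integral_real_affine[where c = t and t = x]) auto
  also have "(\<integral>\<^sup>+s. w (x + t * s) * indicator {x - t..x + t} (x + t * s) \<partial>lborel)
      = (\<integral>\<^sup>+s. w (x + t * s) * indicator {-1..1} s \<partial>lborel)"
  proof (rule nn_integral_cong)
    fix s :: real
    have "x - t \<le> x + t * s \<longleftrightarrow> t * (- 1) \<le> t * s" "x + t * s \<le> x + t \<longleftrightarrow> t * s \<le> t * 1" by auto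
    then have "x + t * s \<in> {x - t..x + t} \<longleftrightarrow> s \<in> {-1..1}"
      using t by (simp only: mult_le_cancel_left_pos atLeastAtMost_iff)
    then show "w (x + t * s) * indicator {x - t..x + t} (x + t * s) = w (x + t * s) * indicator {-1..1} s"
      by (simp only: indicator_def)
  qed
  also have "\<dots> = ennreal 2 * avg t w x"
  proof -
    have "ennreal 2 * (I / 2) = I" for I
      using ennreal_mult_divide_eq[of 2 I] by (simp add: ennreal_times_divide mult.commute[of 2 I])
    then show ?thesis
      unfolding avg_def by (subst nn_integral_uniform_measure) auto
  qed
  finally show ?thesis using t by (simp add: ennreal_mult' mult_ac)
qed

lemma avg_le:
  assumes [measurable]: "w \<in> borel_measurable borel" and t: "t > 0"
    and le: "(\<integral>\<^sup>+y. w y \<partial>lborel) \<le> 1"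
  shows "avg t w x \<le> ennreal (1 / (2 * t))"
proof -
  have "ennreal (2 * t) * avg t w x \<le> (\<integral>\<^sup>+y. w y \<partial>lborel)"
    using t by (subst avg_eq_interval) (auto intro!: nn_integral_mono simp: indicator_def)
  also note le
  finally have "ennreal (1 / (2 * t)) * (ennreal (2 * t) * avg t w x) \<le> ennreal (1 / (2 * t)) * 1"
    by (intro mult_left_mono) auto
  then show ?thesis using t by (simp flip: mult.assoc ennreal_mult')
qed

lemma avg_powr_le:
  assumes [measurable]: "h \<in> borel_measurable borel" and "\<And>y. h y \<ge> 0" "q \<ge> 1" "c \<ge> 0"
    and "ennreal c \<le> avg t (\<lambda>y. ennreal (h y)) x"
  shows "ennreal (c powr q) \<le> avg t (\<lambda>y. ennreal (h y powr q)) x"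
  using assms unfolding avg_def by (intro unif.powr_le_nn_integral_powr) auto

section \<open>Uniform boundedness of averages for log-Hoelder exponents\<close>

text \<open>An integrable weight whose logarithm is at most \<open>2 * ln (exp 1 + \<bar>x\<bar>)\<close> in absolute value,
  hence compatible with the decay condition on the exponent.\<close>

definition cauchy_weight :: "real \<Rightarrow> real" where "cauchy_weight x = inverse (1 + x\<^sup>2)"

lemma cauchy_weight_measurable [measurable]: "cauchy_weight \<in> borel_measurable borel"
  unfolding cauchy_weight_def by measurable

lemma cauchy_weight_bounds: "cauchy_weight x > 0" "cauchy_weight x \<le> 1"
  by (auto simp: cauchy_weight_def add_pos_nonneg inverse_le_1_iff)

lemma nn_integral_cauchy_weight: "(\<integral>\<^sup>+x. ennreal (cauchy_weight x) \<partial>lborel) < \<infinity>"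
proof -
  have "integrable lborel cauchy_weight"
    using integrable_inverse_1_plus_square by (simp add: set_integrable_def cauchy_weight_def[abs_def])
  then show ?thesis using cauchy_weight_bounds(1) by (simp add: integrable_iff_bounded less_imp_le)
qed

locale log_exponent =
  fixes p :: "real \<Rightarrow> real" and c1 c2 c3 :: real
  assumes p_ge_1: "\<And>x. 1 \<le> p x"
    and c1_pos: "c1 > 0" and c2_pos: "c2 > 0"
    and loc: "\<And>x y. \<bar>p x - p y\<bar> * ln (exp 1 + 1 / \<bar>x - y\<bar>) \<le> c1"
    and decay: "\<And>x. \<bar>p x - c3\<bar> * ln (exp 1 + \<bar>x\<bar>) \<le> c2"
begin

lemma ln_exp_1_add_ge_1: "(x::real) \<ge> 0 \<Longrightarrow> ln (exp 1 + x) \<ge> 1"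
  using ln_mono[of "exp 1" "exp 1 + x"] by (simp add: add_pos_nonneg)

lemma p_diff_le: "\<bar>x - y\<bar> \<le> t \<Longrightarrow> t > 0 \<Longrightarrow> p x - p y \<le> c1 / ln (exp 1 + 1 / t)"
proof -
  assume t: "\<bar>x - y\<bar> \<le> t" "t > 0"
  have l: "ln (exp 1 + 1 / t) \<ge> 1" using t by (intro ln_exp_1_add_ge_1) auto
  show ?thesis
  proof (cases "x = y")
    case False
    then have "ln (exp 1 + 1 / t) \<le> ln (exp 1 + 1 / \<bar>x - y\<bar>)"
      using t by (intro ln_mono add_left_mono) (auto intro!: add_pos_pos frac_le)
    then have "\<bar>p x - p y\<bar> * ln (exp 1 + 1 / t) \<le> c1"
      using loc[of x y] by (meson abs_ge_zero mult_left_mono order_trans)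
    then have "\<bar>p x - p y\<bar> \<le> c1 / ln (exp 1 + 1 / t)" using l by (simp add: field_simps)
    then show ?thesis by simp
  qed (use l c1_pos in auto)
qed

lemma continuous_p: "continuous_on UNIV p"
  unfolding continuous_on_iff
proof (intro ballI allI impI)
  fix x e :: real assume e: "e > 0"
  \<comment> \<open>The solution of \<open>c1 / ln (1 / t) = e\<close>.\<close>
  define t where "t = exp (- c1 / e)"
  have t: "t > 0" by (simp add: t_def)
  have "c1 / e = ln (1 / t)" by (simp add: t_def ln_div)
  also have "\<dots> < ln (exp 1 + 1 / t)" using t by (intro ln_less_cancel_iff[THEN iffD2] add_pos_pos) auto
  finally have "c1 / ln (exp 1 + 1 / t) < e"
    using e ln_exp_1_add_ge_1[of "1 / t"] t by (simp add: field_simps)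
  then have "dist (p y) (p x) < e" if "dist y x < t" for y
    using p_diff_le[of x y t] p_diff_le[of y x t] t that by (auto simp: dist_real_def abs_minus_commute)
  with t show "\<exists>d>0. \<forall>x'\<in>UNIV. dist x' x < d \<longrightarrow> dist (p x') (p x) < e" by blast
qed

lemma p_measurable [measurable]: "p \<in> borel_measurable borel"
  by (rule borel_measurable_continuous_onI[OF continuous_p])

lemma p_le: "p x \<le> c3 + c2"
proof -
  have "\<bar>p x - c3\<bar> * 1 \<le> \<bar>p x - c3\<bar> * ln (exp 1 + \<bar>x\<bar>)"
    by (intro mult_left_mono ln_exp_1_add_ge_1) auto
  then have "\<bar>p x - c3\<bar> \<le> c2" using decay[of x] by simp
  then show ?thesis by linarith
qed

text \<open>\<open>c3\<close> is the limit of \<open>p\<close> at infinity.\<close>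

lemma c3_ge_1: "c3 \<ge> 1"
proof (rule ccontr)
  assume "\<not> c3 \<ge> 1"
  then have d: "1 - c3 > 0" by simp
  define x where "x = exp (c2 / (1 - c3))"
  have "x > 0" by (simp add: x_def)
  have "c2 / (1 - c3) = ln x" by (simp add: x_def)
  also have "\<dots> < ln (exp 1 + \<bar>x\<bar>)" using \<open>x > 0\<close> by (intro ln_less_cancel_iff[THEN iffD2] add_pos_pos) auto
  finally have "c2 < (1 - c3) * ln (exp 1 + \<bar>x\<bar>)" using d by (simp add: field_simps)
  also have "\<dots> \<le> \<bar>p x - c3\<bar> * ln (exp 1 + \<bar>x\<bar>)"
    using p_ge_1[of x] ln_exp_1_add_ge_1[of "\<bar>x\<bar>"] by (intro mult_right_mono) auto
  finally show False using decay[of x] by simp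
qed

text \<open>For long intervals the average of \<open>h\<close> is at most \<open>1\<close>, so its powers with exponents above \<open>1\<close> are at most the
  average itself.  For a short interval, Jensen's inequality holds with a constant exponent \<open>q\<close> below \<open>p\<close> on the
  interval, which costs nothing because \<open>h\<close> avoids the values between \<open>0\<close> and \<open>1\<close>.  Passing from \<open>q\<close> back to \<open>p x\<close> costs a power
  of \<open>1 / (2 * t)\<close> with exponent \<open>O(1 / ln (1 / t))\<close>, which is bounded.\<close>

lemma avg_large:
  assumes [measurable]: "h \<in> borel_measurable borel" and h: "\<And>y. h y = 0 \<or> h y \<ge> 1"
    and mod: "(\<integral>\<^sup>+y. ennreal (h y powr p y) \<partial>lborel) \<le> 1" and t: "t > 0"
    and c: "c \<ge> 0" "ennreal c \<le> avg t (\<lambda>y. ennreal (h y)) x"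
  shows "ennreal (c powr p x) \<le> ennreal (exp c1) * avg t (\<lambda>y. ennreal (h y powr p y)) x"
proof -
  let ?h = "\<lambda>y. ennreal (h y)" and ?hp = "\<lambda>y. ennreal (h y powr p y)"
  have h0: "h y \<ge> 0" for y using h[of y] by auto
  have mono: "h y powr a \<le> h y powr b" if "a \<le> b" for y a b
    using h[of y] that by (auto intro: powr_mono)
  have hle: "h y \<le> h y powr p y" for y
    using mono[of 1 "p y" y] p_ge_1[of y] h0[of y] by simp
  have le: "avg t ?hp x \<le> ennreal (1 / (2 * t))"
    using t mod by (intro avg_le) auto
  have le': "avg t ?h x \<le> avg t ?hp x"
    by (intro avg_mono ennreal_leI hle)
  show ?thesis
  proof (cases "t \<ge> 1 / 2")
    case True
    have "ennreal c \<le> ennreal (1 / (2 * t))" using c(2) le le' by order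
    also have "1 / (2 * t) \<le> 1" using True by simp
    finally have "c \<le> 1" by (simp add: ennreal_leI)
    then have "c powr p x \<le> c powr 1"
      using powr_mono'[OF p_ge_1[of x] c(1)] by simp
    then have "c powr p x \<le> c" using c by simp
    then have "ennreal (c powr p x) \<le> 1 * avg t ?hp x"
      using ennreal_leI c(2) le' order_trans by (metis mult_1)
    also have "\<dots> \<le> ennreal (exp c1) * avg t ?hp x"
      using c1_pos by (intro mult_right_mono) auto
    finally show ?thesis .
  next
    case False
    then have t': "1 / (2 * t) > 1" using t by (simp add: field_simps)
    \<comment> \<open>A lower bound for \<open>p\<close> on the interval, by local log-Hoelder continuity at distance at most \<open>t\<close>.\<close>
    define q where "q = max 1 (p x - c1 / ln (exp 1 + 1 / t))"
    have q: "q \<ge> 1" by (simp add: q_def)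
    have l: "ln (exp 1 + 1 / t) \<ge> 1" using t by (intro ln_exp_1_add_ge_1) auto
    have qp: "q \<le> p x" using p_ge_1[of x] c1_pos l by (auto simp: q_def)
    define B where "B = enn2real (avg t ?hp x)"
    have B: "avg t ?hp x = ennreal B" 
      using order_le_less_trans[OF le, of top] by (simp add: B_def)
    have B0: "B \<ge> 0" by (simp add: B_def)
    have B1: "B \<le> 1 / (2 * t)" using le t unfolding B by (simp add: ennreal_le_iff)
    have "ennreal (c powr q) \<le> avg t (\<lambda>y. ennreal (h y powr q)) x"
      using c q h0 by (intro avg_powr_le) auto
    also have "\<dots> \<le> avg t ?hp x"
    proof (intro avg_mono_near ennreal_leI mono)
      fix y assume "\<bar>x - y\<bar> \<le> \<bar>t\<bar>"
      then show "q \<le> p y" using p_diff_le[of x y t] t p_ge_1[of y] by (auto simp: q_def)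
    qed
    finally have cq: "c powr q \<le> B" unfolding B using B0 by (simp add: ennreal_le_iff)
    have "B powr ((p x - q) / q) \<le> (1 / (2 * t)) powr ((p x - q) / q)"
      using B0 B1 q qp by (intro powr_mono2) auto
    also have "\<dots> \<le> (1 / (2 * t)) powr (p x - q)"
    proof (rule powr_mono)
      have "(p x - q) / q \<le> (p x - q) / 1" using q qp by (intro divide_left_mono) auto
      then show "(p x - q) / q \<le> p x - q" by simp
    qed (use t' in simp)
    also have "\<dots> \<le> (1 / (2 * t)) powr (c1 / ln (exp 1 + 1 / t))"
      using t' by (intro powr_mono) (auto simp: q_def)
    also have "\<dots> = exp (c1 * (ln (1 / (2 * t)) / ln (exp 1 + 1 / t)))"
      using t by (simp add: powr_def)
    also have "\<dots> \<le> exp c1"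
    proof -
      have "ln (1 / (2 * t)) \<le> ln (exp 1 + 1 / t)"
        using t by (intro ln_mono) (auto simp: add_pos_pos field_simps)
      then have "ln (1 / (2 * t)) / ln (exp 1 + 1 / t) \<le> 1" using l by (simp add: divide_le_eq)
      then have "c1 * (ln (1 / (2 * t)) / ln (exp 1 + 1 / t)) \<le> c1 * 1"
        using c1_pos by (intro mult_left_mono) auto
      then show ?thesis by simp
    qed
    finally have Bq: "B powr ((p x - q) / q) \<le> exp c1" .
    have "c powr p x = (c powr q) powr (p x / q)" using q by (simp add: powr_powr)
    also have "\<dots> \<le> B powr (p x / q)"
      using cq q qp by (intro powr_mono2) auto
    also have "\<dots> = B * B powr ((p x - q) / q)"
    proof -
      have "p x / q = 1 + (p x - q) / q" using q by (simp add: field_simps)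
      then show ?thesis using B0 by (simp add: powr_add)
    qed
    also have "\<dots> \<le> B * exp c1" using Bq B0 by (intro mult_left_mono) auto
    finally have "c powr p x \<le> exp c1 * B" by (simp add: mult.commute)
    then have "ennreal (c powr p x) \<le> ennreal (exp c1 * B)" by (rule ennreal_leI)
    also have "\<dots> = ennreal (exp c1) * avg t ?hp x" using B0 by (simp add: B ennreal_mult')
    finally show ?thesis .
  qed
qed

text \<open>For \<open>b \<ge> cauchy_weight x\<close>, changing the exponent by at most \<open>\<bar>p x - c3\<bar>\<close> changes \<open>ln (b powr s)\<close> by at most
  \<open>\<bar>p x - c3\<bar> * 2 * ln (exp 1 + \<bar>x\<bar>) \<le> 2 * c2\<close>.  A smaller \<open>b\<close> is absorbed by the weight.\<close>

lemma exponent_swap: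
  assumes b: "0 \<le> b" "b \<le> 1" and s: "s \<ge> 1" "\<bar>s - s'\<bar> \<le> \<bar>p x - c3\<bar>"
  shows "b powr s \<le> exp (2 * c2) * b powr s' + cauchy_weight x"
proof (cases "b \<ge> cauchy_weight x")
  case True
  let ?l = "ln (exp 1 + \<bar>x\<bar>)"
  have b0: "b > 0" using True cauchy_weight_bounds[of x] by linarith
  have "1 + x\<^sup>2 \<le> (exp 1 + \<bar>x\<bar>)\<^sup>2"
  proof -
    have "1 + x\<^sup>2 \<le> (1 + \<bar>x\<bar>)\<^sup>2" by (simp add: power2_eq_square algebra_simps)
    also have "\<dots> \<le> (exp 1 + \<bar>x\<bar>)\<^sup>2" by (intro power_mono) auto
    finally show ?thesis .
  qed
  then have "ln (1 + x\<^sup>2) \<le> ln ((exp 1 + \<bar>x\<bar>)\<^sup>2)" by (intro ln_mono) (auto simp: add_pos_nonneg)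
  also have "\<dots> = 2 * ?l" by (simp add: ln_realpow add_pos_nonneg)
  finally have "- ln (cauchy_weight x) \<le> 2 * ?l" by (simp add: cauchy_weight_def ln_inverse add_pos_nonneg)
  moreover have "ln b \<ge> ln (cauchy_weight x)" using True cauchy_weight_bounds[of x] by (intro ln_mono) auto
  ultimately have lb: "- ln b \<le> 2 * ?l" by linarith
  have "(s - s') * ln b \<le> \<bar>s - s'\<bar> * (- ln b)"
    using mult_right_mono[of "- (s - s')" "\<bar>s - s'\<bar>" "- ln b"] b b0 by (simp add: algebra_simps)
  also have "\<dots> \<le> \<bar>p x - c3\<bar> * (2 * ?l)"
    using s(2) lb b b0 by (intro mult_mono) auto
  also have "\<dots> \<le> 2 * c2" using decay[of x] by simp
  finally have "b powr (s - s') \<le> exp (2 * c2)" using b0 by (simp add: powr_def)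
  then have "b powr (s - s') * b powr s' \<le> exp (2 * c2) * b powr s'"
    by (intro mult_right_mono) auto
  then have "b powr s \<le> exp (2 * c2) * b powr s'" by (simp flip: powr_add)
  then show ?thesis using cauchy_weight_bounds(1)[of x] by linarith
next
  case False
  have "b powr s \<le> b" using powr_mono'[OF s(1) b] b by simp
  then show ?thesis using False by (smt (verit) exp_ge_zero mult_nonneg_nonneg powr_ge_zero)
qed

text \<open>For a function with values in \<open>[0, 1]\<close>, replace the exponent \<open>p\<close> by the constant \<open>c3\<close>, apply
  Jensen's inequality, and change back; each change adds an integrable weight.\<close>

lemma avg_small:
  assumes [measurable]: "h \<in> borel_measurable borel" and h: "\<And>y. 0 \<le> h y" "\<And>y. h y \<le> 1"
    and c: "c \<ge> 0" "ennreal c \<le> avg t (\<lambda>y. ennreal (h y)) x"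
  shows "ennreal (c powr p x) \<le> ennreal (exp (2 * c2)) *
    avg t (\<lambda>y. ennreal (exp (2 * c2)) * ennreal (h y powr p y) + ennreal (cauchy_weight y)) x + ennreal (cauchy_weight x)"
proof -
  let ?K = "exp (2 * c2)"
  have "ennreal c \<le> avg t (\<lambda>y. 1) x"
    using c(2) avg_mono[of "\<lambda>y. ennreal (h y)" "\<lambda>y. 1" t x] h by (metis ennreal_1 ennreal_leI order_trans)
  then have c1: "c \<le> 1" by (simp add: avg_const)
  have "c powr p x \<le> ?K * c powr c3 + cauchy_weight x"
    using c c1 p_ge_1 by (intro exponent_swap) auto
  then have "ennreal (c powr p x) \<le> ennreal (?K * c powr c3 + cauchy_weight x)" by (rule ennreal_leI)
  also have "\<dots> = ennreal ?K * ennreal (c powr c3) + ennreal (cauchy_weight x)"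
    using cauchy_weight_bounds(1)[of x] by (simp add: ennreal_mult')
  also have "ennreal (c powr c3) \<le> avg t (\<lambda>y. ennreal (h y powr c3)) x"
    using c h c3_ge_1 by (intro avg_powr_le) auto
  also have "\<dots> \<le> avg t (\<lambda>y. ennreal ?K * ennreal (h y powr p y) + ennreal (cauchy_weight y)) x"
  proof (rule avg_mono)
    fix y
    have "h y powr c3 \<le> ?K * h y powr p y + cauchy_weight y"
      using h c3_ge_1 by (intro exponent_swap) (auto simp: abs_minus_commute)
    then have "ennreal (h y powr c3) \<le> ennreal (?K * h y powr p y + cauchy_weight y)" by (rule ennreal_leI)
    then show "ennreal (h y powr c3) \<le> ennreal ?K * ennreal (h y powr p y) + ennreal (cauchy_weight y)"
      using cauchy_weight_bounds(1)[of y] by (simp add: ennreal_mult')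
  qed
  finally show ?thesis by (simp add: mult_left_mono add_right_mono)
qed

definition avg_bound :: ennreal where
  "avg_bound = ennreal (2 powr (c3 + c2)) * (ennreal (exp c1) + (ennreal (exp (2 * c2)) *
    (ennreal (exp (2 * c2)) + (\<integral>\<^sup>+x. ennreal (cauchy_weight x) \<partial>lborel)) + (\<integral>\<^sup>+x. ennreal (cauchy_weight x) \<partial>lborel)))"

lemma avg_bound_finite: "avg_bound < \<infinity>"
  using nn_integral_cauchy_weight by (simp add: avg_bound_def ennreal_mult_less_top less_top)

text \<open>The estimate that replaces Young's convolution inequality, which fails for variable exponents.
  The bound does not depend on \<open>t\<close>: the large values of \<open>h\<close> use the local condition on \<open>p\<close> only
  for small \<open>t\<close>, and the small values use only the decay condition.\<close>

theorem modular_avg_le: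
  assumes [measurable]: "h \<in> borel_measurable borel" and h: "\<And>y. 0 \<le> h y"
    and mod: "(\<integral>\<^sup>+y. ennreal (h y powr p y) \<partial>lborel) \<le> 1" and t: "t > 0"
  shows "(\<integral>\<^sup>+x. ennreal (enn2real (avg t (\<lambda>y. ennreal (h y)) x) powr p x) \<partial>lborel) \<le> avg_bound"
    "avg t (\<lambda>y. ennreal (h y)) x \<le> ennreal (1 + 1 / (2 * t))"
proof -
  define h1 where "h1 y = (if h y \<ge> 1 then h y else 0)" for y
  define h2 where "h2 y = (if h y \<ge> 1 then 0 else h y)" for y
  have [measurable]: "h1 \<in> borel_measurable borel" "h2 \<in> borel_measurable borel"
    unfolding h1_def h2_def by measurable
  have h1: "h1 y = 0 \<or> h1 y \<ge> 1" "h1 y \<ge> 0" for y using h by (auto simp: h1_def)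
  have h2: "0 \<le> h2 y" "h2 y \<le> 1" for y using h[of y] by (auto simp: h2_def)
  have mod1: "(\<integral>\<^sup>+y. ennreal (h1 y powr p y) \<partial>lborel) \<le> 1"
    by (rule order_trans[OF nn_integral_mono mod]) (auto simp: h1_def intro!: ennreal_leI)
  have mod2: "(\<integral>\<^sup>+y. ennreal (h2 y powr p y) \<partial>lborel) \<le> 1"
    by (rule order_trans[OF nn_integral_mono mod]) (auto simp: h2_def intro!: ennreal_leI)
  have sum: "avg t (\<lambda>y. ennreal (h y)) x = avg t (\<lambda>y. ennreal (h1 y)) x + avg t (\<lambda>y. ennreal (h2 y)) x" for x
    by (subst avg_add[symmetric]) (auto simp: h1_def h2_def intro!: arg_cong[where f = "\<lambda>w. avg t w x"])
  have le1: "avg t (\<lambda>y. ennreal (h1 y)) x \<le> ennreal (1 / (2 * t))" for x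
  proof -
    have "h1 y \<le> h1 y powr p y" for y
      using powr_mono[OF p_ge_1[of y], of "h1 y"] h1[of y] by auto
    then have "avg t (\<lambda>y. ennreal (h1 y)) x \<le> avg t (\<lambda>y. ennreal (h1 y powr p y)) x"
      by (intro avg_mono ennreal_leI)
    also have "\<dots> \<le> ennreal (1 / (2 * t))" using mod1 t by (intro avg_le) auto
    finally show ?thesis .
  qed
  have le2: "avg t (\<lambda>y. ennreal (h2 y)) x \<le> 1" for x
    using avg_mono[of "\<lambda>y. ennreal (h2 y)" "\<lambda>y. 1" t x] h2 by (simp add: avg_const ennreal_le_1)
  show "avg t (\<lambda>y. ennreal (h y)) x \<le> ennreal (1 + 1 / (2 * t))" for x
    unfolding sum using add_mono[OF le2[of x] le1[of x]] t by (simp add: add.commute)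
  let ?K = "ennreal (exp (2 * c2))"
  let ?L = "\<lambda>x. ennreal (exp c1) * avg t (\<lambda>y. ennreal (h1 y powr p y)) x"
  let ?S = "\<lambda>x. ?K * avg t (\<lambda>y. ?K * ennreal (h2 y powr p y) + ennreal (cauchy_weight y)) x + ennreal (cauchy_weight x)"
  have "ennreal (enn2real (avg t (\<lambda>y. ennreal (h y)) x) powr p x) \<le> ennreal (2 powr (c3 + c2)) * (?L x + ?S x)" for x
  proof -
    define a1 where "a1 = enn2real (avg t (\<lambda>y. ennreal (h1 y)) x)"
    define a2 where "a2 = enn2real (avg t (\<lambda>y. ennreal (h2 y)) x)"
    have a: "a1 \<ge> 0" "a2 \<ge> 0" by (auto simp: a1_def a2_def)
    have e1: "avg t (\<lambda>y. ennreal (h1 y)) x = ennreal a1"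
      using order_le_less_trans[OF le1[of x], of top] by (simp add: a1_def)
    have e2: "avg t (\<lambda>y. ennreal (h2 y)) x = ennreal a2"
      using order_le_less_trans[OF le2[of x], of top] by (simp add: a2_def)
    have "enn2real (avg t (\<lambda>y. ennreal (h y)) x) powr p x = (a1 + a2) powr p x"
      using a unfolding sum e1 e2 by (simp flip: ennreal_plus)
    also have "(a1 + a2) powr p x \<le> (2 * max a1 a2) powr p x"
      using a p_ge_1[of x] by (intro powr_mono2) auto
    also have "\<dots> = 2 powr p x * max a1 a2 powr p x"
      using a by (intro powr_mult) 
    also have "\<dots> \<le> 2 powr (c3 + c2) * (a1 powr p x + a2 powr p x)"
      using p_le[of x] by (intro mult_mono powr_mono) (auto simp: max_def)
    finally have "ennreal (enn2real (avg t (\<lambda>y. ennreal (h y)) x) powr p x)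
        \<le> ennreal (2 powr (c3 + c2) * (a1 powr p x + a2 powr p x))"
      by (rule ennreal_leI)
    also have "\<dots> = ennreal (2 powr (c3 + c2)) * (ennreal (a1 powr p x) + ennreal (a2 powr p x))"
      by (simp add: ennreal_mult')
    also have "\<dots> \<le> ennreal (2 powr (c3 + c2)) * (?L x + ?S x)"
    proof (intro mult_left_mono add_mono)
      show "ennreal (a1 powr p x) \<le> ?L x" using h1 mod1 t a e1 by (intro avg_large) auto
      show "ennreal (a2 powr p x) \<le> ?S x" using h2 a e2 by (intro avg_small) auto
    qed auto
    finally show ?thesis .
  qed
  then have "(\<integral>\<^sup>+x. ennreal (enn2real (avg t (\<lambda>y. ennreal (h y)) x) powr p x) \<partial>lborel)
      \<le> (\<integral>\<^sup>+x. ennreal (2 powr (c3 + c2)) * (?L x + ?S x) \<partial>lborel)"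
    by (rule nn_integral_mono)
  also have "\<dots> = ennreal (2 powr (c3 + c2)) * (ennreal (exp c1) * (\<integral>\<^sup>+y. ennreal (h1 y powr p y) \<partial>lborel) +
      (?K * (?K * (\<integral>\<^sup>+y. ennreal (h2 y powr p y) \<partial>lborel) + (\<integral>\<^sup>+x. ennreal (cauchy_weight x) \<partial>lborel))
        + (\<integral>\<^sup>+x. ennreal (cauchy_weight x) \<partial>lborel)))"
    by (simp add: nn_integral_cmult nn_integral_add nn_integral_avg)
  also have "\<dots> \<le> ennreal (2 powr (c3 + c2)) * (ennreal (exp c1) * 1 +
      (?K * (?K * 1 + (\<integral>\<^sup>+x. ennreal (cauchy_weight x) \<partial>lborel)) + (\<integral>\<^sup>+x. ennreal (cauchy_weight x) \<partial>lborel)))"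
    by (intro mult_left_mono add_mono order_refl mod1 mod2) auto
  finally show "(\<integral>\<^sup>+x. ennreal (enn2real (avg t (\<lambda>y. ennreal (h y)) x) powr p x) \<partial>lborel) \<le> avg_bound"
    by (simp add: avg_bound_def)
qed

end

section \<open>Forward differences\<close>

primrec forward_difference :: "nat \<Rightarrow> real \<Rightarrow> (real \<Rightarrow> 'a::ab_group_add) \<Rightarrow> real \<Rightarrow> 'a" where
  "forward_difference 0 t f x = f x"
| "forward_difference (Suc n) t f x = forward_difference n t f (x + t) - forward_difference n t f x"

lemma forward_difference_eq_sum:
  fixes f :: "real \<Rightarrow> complex"
  shows "forward_difference n t f x = (\<Sum>v\<le>n. (-1) ^ (n + v) * of_nat (n choose v) * f (x + real v * t))"
proof (induction n arbitrary: x)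
  case (Suc n)
  let ?a = "\<lambda>v. (-1) ^ (n + v) * of_nat (n choose v) * f (x + real v * t)"
  let ?b = "\<lambda>v. (-1) ^ (n + v) * of_nat (n choose v) * f (x + real (Suc v) * t)"
  let ?c = "\<lambda>v. (-1) ^ (n + v) * of_nat (n choose Suc v) * f (x + real (Suc v) * t)"
  have a: "sum ?a {..n} = ?a 0 - sum ?c {..n}"
  proof -
    have "sum ?a {..n} = sum ?a {..Suc n}" by simp
    also have "\<dots> = ?a 0 + (\<Sum>v\<le>n. ?a (Suc v))" by (rule sum.atMost_Suc_shift)
    also have "(\<Sum>v\<le>n. ?a (Suc v)) = - sum ?c {..n}" by (simp flip: sum_negf)
    finally show ?thesis by simp
  qed
  have "(\<Sum>v\<le>Suc n. (-1) ^ (Suc n + v) * of_nat (Suc n choose v) * f (x + real v * t))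
     = - ?a 0 + (\<Sum>v\<le>n. (-1) ^ (Suc n + Suc v) * of_nat (Suc n choose Suc v) * f (x + real (Suc v) * t))"
    by (subst sum.atMost_Suc_shift) simp
  also have "\<dots> = - ?a 0 + (sum ?b {..n} + sum ?c {..n})"
    unfolding sum.distrib[symmetric]
    by (intro arg_cong2[where f = "(+)"] sum.cong refl) (simp add: ring_distribs)
  also have "\<dots> = sum ?b {..n} - sum ?a {..n}"
    unfolding a by (rule diff_diff_eq2[THEN trans, symmetric]) (simp only: diff_conv_add_uminus ac_simps)
  also have "\<dots> = forward_difference (Suc n) t f x"
    by (simp add: Suc.IH algebra_simps)
  finally show ?case by simp
qed simp

lemma forward_difference_has_vector_derivative:
  fixes f :: "real \<Rightarrow> 'a::real_normed_vector"
  assumes "\<And>x. (f has_vector_derivative f' x) (at x)"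
  shows "(forward_difference n t f has_vector_derivative forward_difference n t f' x) (at x)"
proof (induction n arbitrary: x)
  case (Suc n)
  have shift: "((\<lambda>x. x + t) has_vector_derivative 1) (at x)" by (auto intro!: derivative_eq_intros)
  have "((forward_difference n t f \<circ> (\<lambda>x. x + t)) has_vector_derivative 1 *\<^sub>R forward_difference n t f' (x + t)) (at x)"
    by (rule vector_diff_chain_at[OF shift Suc.IH])
  note has_vector_derivative_diff[OF this Suc.IH[of x]]
  moreover have "forward_difference (Suc n) t f =
      (\<lambda>x. (forward_difference n t f \<circ> (\<lambda>x. x + t)) x - forward_difference n t f x)"
    by (simp add: fun_eq_iff)
  ultimately show ?case by simp
next
  case 0
  have "forward_difference 0 t f = f" by (simp add: fun_eq_iff)
  then show ?case using assms by simp
qed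

text \<open>The mean value inequality removes one difference at the price of a factor \<open>\<bar>t\<bar>\<close> and one
  derivative; the last difference is kept, because the derivative of order \<open>n\<close> need not be differentiable
  everywhere.\<close>

lemma forward_difference_norm_le:
  fixes u :: "nat \<Rightarrow> real \<Rightarrow> 'a::real_normed_vector"
  assumes "\<And>j x. j < n \<Longrightarrow> (u j has_vector_derivative u (Suc j) x) (at x)"
    and "\<And>z. \<bar>z - x\<bar> \<le> real n * \<bar>t\<bar> \<Longrightarrow> norm (u n (z + t) - u n z) \<le> B"
  shows "norm (forward_difference (Suc n) t (u 0) x) \<le> \<bar>t\<bar> ^ n * B"
  using assms
proof (induction n arbitrary: u x)
  case 0
  from 0(2)[of x] show ?case by simp
next
  case (Suc n)
  have IH: "norm (forward_difference (Suc n) t (u 1) z) \<le> \<bar>t\<bar> ^ n * B" if z: "\<bar>z - x\<bar> \<le> \<bar>t\<bar>" for z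
  proof -
    have "norm (forward_difference (Suc n) t ((\<lambda>j. u (Suc j)) 0) z) \<le> \<bar>t\<bar> ^ n * B"
    proof (rule Suc.IH)
      show "(u (Suc j) has_vector_derivative u (Suc (Suc j)) x) (at x)" if "j < n" for j x
        using Suc.prems(1) that by simp
      fix y assume "\<bar>y - z\<bar> \<le> real n * \<bar>t\<bar>"
      then have "\<bar>y - x\<bar> \<le> real (Suc n) * \<bar>t\<bar>" using z by (simp add: algebra_simps)
      then show "norm (u (Suc n) (y + t) - u (Suc n) y) \<le> B" by (rule Suc.prems(2))
    qed
    then show ?thesis by simp
  qed
  let ?\<phi> = "forward_difference (Suc n) t (u 0)" and ?\<phi>' = "forward_difference (Suc n) t (u 1)"
  have "norm (?\<phi> (x + t) - ?\<phi> x) \<le> \<bar>t\<bar> ^ n * B * norm (x + t - x)"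
  proof (rule differentiable_bound)
    show "convex (closed_segment x (x + t))" by simp
    fix z assume z: "z \<in> closed_segment x (x + t)"
    then have "norm (z - x) \<le> norm (x + t - x)" by (rule segment_bound)
    then have zx: "\<bar>z - x\<bar> \<le> \<bar>t\<bar>" by simp
    have "(?\<phi> has_vector_derivative ?\<phi>' z) (at z)"
      using Suc.prems(1)[of 0] by (intro forward_difference_has_vector_derivative) simp
    then show "(?\<phi> has_derivative (\<lambda>h. h *\<^sub>R ?\<phi>' z)) (at z within closed_segment x (x + t))"
      unfolding has_vector_derivative_def by (rule has_derivative_at_withinI)
    show "onorm (\<lambda>h. h *\<^sub>R ?\<phi>' z) \<le> \<bar>t\<bar> ^ n * B"
      using IH[OF zx] by (intro onorm_le) (simp add: mult.commute mult_left_mono)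
  qed auto
  then show ?case by (simp add: mult_ac)
qed

section \<open>Moments of the Bernstein kernel\<close>

text \<open>\<open>bernstein_g \<sigma> r\<close> is, up to a constant factor, the dilation of this function by \<open>\<sigma> / (2 * real r)\<close>, so every dependence on
  \<open>\<sigma>\<close> below is a power of \<open>\<sigma>\<close>.\<close>

definition sinc_power :: "nat \<Rightarrow> real \<Rightarrow> real" where
  "sinc_power r s = (1 / s * sin s) ^ (2 * r)"

lemma sinc_power_measurable [measurable]: "sinc_power r \<in> borel_measurable borel"
  unfolding sinc_power_def by measurable

lemma sinc_power_nonneg: "sinc_power r s \<ge> 0"
  by (simp add: sinc_power_def zero_le_even_power)

lemma sinc_power_eq_abs: "sinc_power r s = \<bar>1 / s * sin s\<bar> ^ (2 * r)"
  unfolding sinc_power_def by (rule power_even_abs[symmetric]) simp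

lemma sinc_power_le_1: "sinc_power r s \<le> 1"
proof -
  have "\<bar>1 / s * sin s\<bar> \<le> 1"
    using abs_sin_x_le_abs_x[of s] by (cases "s = 0") (auto simp: field_simps)
  then have "\<bar>1 / s * sin s\<bar> ^ (2 * r) \<le> 1" by (intro power_le_one) auto
  then show ?thesis by (simp only: sinc_power_eq_abs)
qed

definition moment :: "nat \<Rightarrow> nat \<Rightarrow> real" where
  "moment r j = enn2real (\<integral>\<^sup>+s. ennreal (sinc_power r s * \<bar>s\<bar> ^ j) \<partial>lborel)"

text \<open>The condition on \<open>j\<close> is where \<open>k + 2 \<le> 2 * r\<close> enters: the kernel has a finite moment of
  order \<open>k\<close>.\<close>

lemma sinc_power_moment_bound:
  assumes "j + 2 \<le> 2 * r"
  shows "sinc_power r s * \<bar>s\<bar> ^ j \<le> 2 * inverse (1 + s\<^sup>2)"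
proof (cases "\<bar>s\<bar> \<le> 1")
  case True
  have "sinc_power r s * \<bar>s\<bar> ^ j \<le> 1 * 1"
    using True by (intro mult_mono sinc_power_le_1 sinc_power_nonneg power_le_one) auto
  also have "1 * 1 \<le> 2 * inverse (1 + s\<^sup>2)"
    using True by (simp add: field_simps add_pos_nonneg abs_square_le_1)
  finally show ?thesis .
next
  case False
  then have s: "\<bar>s\<bar> > 1" by simp
  have "\<bar>1 / s * sin s\<bar> \<le> 1 / \<bar>s\<bar>" using s by (simp add: abs_mult field_simps)
  then have "\<bar>1 / s * sin s\<bar> ^ (2 * r) \<le> (1 / \<bar>s\<bar>) ^ (2 * r)" by (intro power_mono) auto
  then have "sinc_power r s * \<bar>s\<bar> ^ j \<le> (1 / \<bar>s\<bar>) ^ (2 * r) * \<bar>s\<bar> ^ j"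
    unfolding sinc_power_eq_abs by (intro mult_right_mono) auto
  also have "\<dots> \<le> 1 / \<bar>s\<bar> ^ 2"
  proof -
    have "\<bar>s\<bar> ^ (j + 2) \<le> \<bar>s\<bar> ^ (2 * r)" using s assms by (intro power_increasing) auto
    then have "\<bar>s\<bar> ^ j * \<bar>s\<bar>\<^sup>2 \<le> \<bar>s\<bar> ^ (2 * r)" by (simp only: power_add)
    moreover have "(1 / \<bar>s\<bar>) ^ (2 * r) * \<bar>s\<bar> ^ j = \<bar>s\<bar> ^ j / \<bar>s\<bar> ^ (2 * r)" by (simp add: power_divide)
    ultimately show ?thesis using s by (simp only: divide_le_eq_1_pos pos_divide_le_eq pos_le_divide_eq zero_less_power) (auto simp: field_simps)
  qed
  also have "\<dots> \<le> 2 * inverse (1 + s\<^sup>2)"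
  proof -
    have "s\<^sup>2 > 1" using s by (metis one_less_power pos2 power2_abs)
    then have "2 / (s\<^sup>2 + s\<^sup>2) \<le> 2 / (1 + s\<^sup>2)"
      by (intro divide_left_mono mult_pos_pos add_pos_pos) auto
    moreover have "2 / (s\<^sup>2 + s\<^sup>2) = 1 / \<bar>s\<bar>\<^sup>2" by simp
    ultimately show ?thesis by (simp add: inverse_eq_divide)
  qed
  finally show ?thesis .
qed

lemma moment_finite:
  assumes "j + 2 \<le> 2 * r"
  shows "(\<integral>\<^sup>+s. ennreal (sinc_power r s * \<bar>s\<bar> ^ j) \<partial>lborel) = ennreal (moment r j)"
proof -
  have "(\<integral>\<^sup>+s. ennreal (sinc_power r s * \<bar>s\<bar> ^ j) \<partial>lborel) \<le> (\<integral>\<^sup>+s. ennreal (2 * inverse (1 + s\<^sup>2)) \<partial>lborel)"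
    by (intro nn_integral_mono ennreal_leI sinc_power_moment_bound assms)
  also have "\<dots> < \<infinity>"
  proof -
    have "integrable lborel (\<lambda>s::real. 2 * inverse (1 + s\<^sup>2))"
      using integrable_inverse_1_plus_square by (simp add: set_integrable_def)
    then have "(\<integral>\<^sup>+s. ennreal (2 * inverse (1 + s\<^sup>2)) \<partial>lborel) = ennreal (LINT s|lborel. 2 * inverse (1 + s\<^sup>2))"
      by (rule nn_integral_eq_integral) (auto simp: add_pos_nonneg less_imp_le)
    then show ?thesis by (simp only: ennreal_less_top infinity_ennreal_def)
  qed
  finally show ?thesis by (simp add: moment_def)
qed

lemma moment_pos:
  assumes "j + 2 \<le> 2 * r"
  shows "moment r j > 0"
proof -
  have "(\<integral>\<^sup>+s. ennreal (sinc_power r s * \<bar>s\<bar> ^ j) \<partial>lborel) \<noteq> 0"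
  proof
    assume "(\<integral>\<^sup>+s. ennreal (sinc_power r s * \<bar>s\<bar> ^ j) \<partial>lborel) = 0"
    then have "AE s in lborel. ennreal (sinc_power r s * \<bar>s\<bar> ^ j) = 0"
      by (subst (asm) nn_integral_0_iff_AE) auto
    then have "AE s in lborel. s \<notin> {0<..<1::real}"
    proof eventually_elim
      case (elim s)
      show ?case
      proof
        assume s: "s \<in> {0<..<1}"
        then have "sin s > 0" using pi_gt3 by (intro sin_gt_zero) auto
        with s have "sinc_power r s * \<bar>s\<bar> ^ j > 0" by (auto simp: sinc_power_def)
        with elim show False by (metis ennreal_eq_0_iff not_le)
      qed
    qed
    then have "emeasure lborel {0<..<1::real} = 0"
      by (subst (asm) AE_iff_measurable[where N = "{0<..<1}"]) auto
    then show False by simp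
  qed
  then show ?thesis unfolding moment_finite[OF assms] by (simp add: ennreal_eq_0_iff not_le)
qed

lemma bernstein_g_eq:
  assumes "\<sigma> > 0" "r \<ge> 1"
  shows "bernstein_g \<sigma> r x = (\<sigma> / (2 * real r)) ^ (2 * r) * sinc_power r (\<sigma> / (2 * real r) * x)"
proof -
  let ?a = "\<sigma> / (2 * real r)"
  have "?a * (1 / (?a * x)) = 1 / x" using assms by simp
  then have "1 / x * sin (?a * x) = ?a * (1 / (?a * x) * sin (?a * x))" by (metis mult.assoc)
  moreover have "\<sigma> * x / (2 * real r) = ?a * x" by simp
  ultimately have "bernstein_g \<sigma> r x = (?a * (1 / (?a * x) * sin (?a * x))) ^ (2 * r)"
    unfolding bernstein_g_def by metis
  then show ?thesis unfolding sinc_power_def power_mult_distrib[symmetric] .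
qed

lemma bernstein_g_measurable [measurable]: "bernstein_g \<sigma> r \<in> borel_measurable borel"
  unfolding bernstein_g_def by measurable

lemma bernstein_g_nonneg: "bernstein_g \<sigma> r x \<ge> 0"
  by (simp add: bernstein_g_def zero_le_even_power)

lemma nn_integral_bernstein_g_moment:
  assumes "\<sigma> > 0" and j: "j + 2 \<le> 2 * r"
  shows "(\<integral>\<^sup>+t. ennreal (bernstein_g \<sigma> r t * \<bar>t\<bar> ^ j) \<partial>lborel)
    = ennreal ((\<sigma> / (2 * real r)) ^ (2 * r) / (\<sigma> / (2 * real r)) ^ (j + 1) * moment r j)"
proof -
  define a where "a = \<sigma> / (2 * real r)"
  have r: "r \<ge> 1" using j by auto
  then have a: "a > 0" using assms by (simp add: a_def)
  have "ennreal (moment r j) = (\<integral>\<^sup>+s. ennreal (sinc_power r s * \<bar>s\<bar> ^ j) \<partial>lborel)"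
    by (rule moment_finite[OF j, symmetric])
  also have "\<dots> = ennreal a * (\<integral>\<^sup>+t. ennreal (sinc_power r (a * t) * \<bar>a * t\<bar> ^ j) \<partial>lborel)"
    using a nn_integral_real_affine[of "\<lambda>s. ennreal (sinc_power r s * \<bar>s\<bar> ^ j)" a 0] by simp
  finally have *: "ennreal (moment r j) = ennreal a * (\<integral>\<^sup>+t. ennreal (sinc_power r (a * t) * \<bar>a * t\<bar> ^ j) \<partial>lborel)" .
  have "(\<integral>\<^sup>+t. ennreal (bernstein_g \<sigma> r t * \<bar>t\<bar> ^ j) \<partial>lborel)
      = (\<integral>\<^sup>+t. ennreal (a ^ (2 * r) / a ^ j) * ennreal (sinc_power r (a * t) * \<bar>a * t\<bar> ^ j) \<partial>lborel)"
  proof (rule nn_integral_cong)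
    fix t
    have "bernstein_g \<sigma> r t * \<bar>t\<bar> ^ j = a ^ (2 * r) / a ^ j * (sinc_power r (a * t) * \<bar>a * t\<bar> ^ j)"
      using a unfolding bernstein_g_eq[OF assms(1) r] a_def[symmetric] by (simp add: abs_mult power_mult_distrib)
    then show "ennreal (bernstein_g \<sigma> r t * \<bar>t\<bar> ^ j) =
        ennreal (a ^ (2 * r) / a ^ j) * ennreal (sinc_power r (a * t) * \<bar>a * t\<bar> ^ j)"
      using a by (simp only: ennreal_mult' divide_nonneg_nonneg zero_le_power less_imp_le)
  qed
  also have "\<dots> = ennreal (a ^ (2 * r) / a ^ j) * (\<integral>\<^sup>+t. ennreal (sinc_power r (a * t) * \<bar>a * t\<bar> ^ j) \<partial>lborel)"
    by (rule nn_integral_cmult) measurable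
  also have "ennreal (a ^ (2 * r) / a ^ j) = ennreal (a ^ (2 * r) / a ^ (j + 1)) * ennreal a"
    using a by (simp flip: ennreal_mult')
  finally have "(\<integral>\<^sup>+t. ennreal (bernstein_g \<sigma> r t * \<bar>t\<bar> ^ j) \<partial>lborel) = ennreal (a ^ (2 * r) / a ^ (j + 1)) * ennreal (moment r j)"
    unfolding * by (simp only: mult.assoc)
  then show ?thesis unfolding a_def[symmetric] by (subst ennreal_mult') (use a in auto)
qed

lemma bernstein_gamma_eq:
  assumes "\<sigma> > 0" "r \<ge> 1"
  shows "bernstein_gamma r \<sigma> = (\<sigma> / (2 * real r)) ^ (2 * r) / (\<sigma> / (2 * real r)) * moment r 0"
    and "bernstein_gamma r \<sigma> = (LINT t|lborel. bernstein_g \<sigma> r t)"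
    and "integrable lborel (bernstein_g \<sigma> r)"
    and "bernstein_gamma r \<sigma> > 0"
proof -
  let ?v = "(\<sigma> / (2 * real r)) ^ (2 * r) / (\<sigma> / (2 * real r)) * moment r 0"
  have v: "(\<integral>\<^sup>+t. ennreal (bernstein_g \<sigma> r t) \<partial>lborel) = ennreal ?v"
    using nn_integral_bernstein_g_moment[of \<sigma> 0 r] assms by simp
  have v0: "?v > 0" using assms moment_pos[of 0 r] by simp
  show int: "integrable lborel (bernstein_g \<sigma> r)"
    using v by (auto simp: integrable_iff_bounded bernstein_g_nonneg)
  have "bernstein_gamma r \<sigma> = (LINT t|lebesgue. bernstein_g \<sigma> r t)"
    by (simp add: bernstein_gamma_def bernstein_g_def)
  also have "\<dots> = (LINT t|lborel. bernstein_g \<sigma> r t)"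
    by (rule integral_completion) simp
  finally show g: "bernstein_gamma r \<sigma> = (LINT t|lborel. bernstein_g \<sigma> r t)" .
  have "(LINT t|lborel. bernstein_g \<sigma> r t) = ?v"
    using v v0 by (subst integral_eq_nn_integral) (auto simp: bernstein_g_nonneg)
  with g v0 show "bernstein_gamma r \<sigma> = ?v" "bernstein_gamma r \<sigma> > 0" by simp_all
qed

lemma modular_eq_lborel: "modular p f = (\<integral>\<^sup>+y. ennreal (cmod (f y) powr p y) \<partial>lborel)"
  by (simp add: modular_def nn_integral_completion)

lemma le_1_plus_powr:
  fixes a q :: real
  assumes "0 \<le> a" "1 \<le> q"
  shows "a \<le> 1 + a powr q"
proof (cases "a \<le> 1")
  case True
  then show ?thesis by (rule add_increasing2[OF powr_ge_zero])
next
  case False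
  then have "a powr 1 \<le> a powr q" using assms by (intro powr_mono) auto
  then show ?thesis using assms by simp
qed

section \<open>The modular\<close>

text \<open>Because \<open>p \<ge> 1\<close>.  This turns any finite bound of a modular into a bound of the norm.\<close>

lemma modular_scale_le:
  assumes p: "\<And>x. 1 \<le> p x" and s: "s \<ge> 1"
    and [measurable]: "f \<in> borel_measurable lebesgue" "p \<in> borel_measurable lebesgue"
  shows "modular p (\<lambda>x. f x / complex_of_real s) \<le> ennreal (1 / s) * modular p f"
proof -
  have "modular p (\<lambda>x. f x / complex_of_real s) \<le> (\<integral>\<^sup>+y. ennreal (1 / s) * ennreal (cmod (f y) powr p y) \<partial>lebesgue)"
    unfolding modular_def
  proof (rule nn_integral_mono)
    fix y
    have "(1 / s) powr p y \<le> (1 / s) powr 1" using s p[of y] by (intro powr_mono') auto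
    then have "(1 / s) powr p y \<le> 1 / s" using s by simp
    then have "cmod (f y) powr p y * (1 / s) powr p y \<le> cmod (f y) powr p y * (1 / s)"
      by (intro mult_left_mono) auto
    moreover have "cmod (f y / complex_of_real s) powr p y = cmod (f y) powr p y * (1 / s) powr p y"
      using s by (simp add: norm_divide powr_mult[symmetric])
    ultimately have "cmod (f y / complex_of_real s) powr p y \<le> 1 / s * cmod (f y) powr p y" by simp
    then have "ennreal (cmod (f y / complex_of_real s) powr p y) \<le> ennreal (1 / s * cmod (f y) powr p y)"
      by (rule ennreal_leI)
    then show "ennreal (cmod (f y / complex_of_real s) powr p y) \<le> ennreal (1 / s) * ennreal (cmod (f y) powr p y)"
      using s by (subst (asm) ennreal_mult') auto
  qed
  also have "\<dots> = ennreal (1 / s) * modular p f"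
    unfolding modular_def by (rule nn_integral_cmult) measurable
  finally show ?thesis .
qed

lemma modular_scale_less_1:
  assumes p: "\<And>x. 1 \<le> p x" and le: "modular p f \<le> ennreal M" and M: "M \<ge> 0"
    and m: "f \<in> borel_measurable lebesgue" "p \<in> borel_measurable lebesgue"
  shows "modular p (\<lambda>x. f x / complex_of_real (M + 1)) < 1"
proof -
  have "modular p (\<lambda>x. f x / complex_of_real (M + 1)) \<le> ennreal (1 / (M + 1)) * modular p f"
    using M by (intro modular_scale_le p m) auto
  also have "\<dots> \<le> ennreal (1 / (M + 1)) * ennreal M" using le by (intro mult_left_mono) auto
  also have "\<dots> = ennreal (M / (M + 1))" using M by (simp flip: ennreal_mult')
  also have "\<dots> < 1" using M by (simp add: ennreal_less_one_iff)
  finally show ?thesis .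
qed

lemma Lp_var_modular_less_1:
  assumes f: "f \<in> Lp_var p" and p: "\<And>x. 1 \<le> p x" "p \<in> borel_measurable lebesgue"
  obtains \<eta> where "\<eta> > 0" "modular p (\<lambda>x. f x / complex_of_real \<eta>) < 1"
proof -
  from f obtain l where l: "l > 0" "modular p (\<lambda>x. f x / complex_of_real l) < \<infinity>"
    and [measurable]: "f \<in> borel_measurable lebesgue" by (auto simp: Lp_var_def)
  define M where "M = enn2real (modular p (\<lambda>x. f x / complex_of_real l))"
  have "modular p (\<lambda>x. f x / complex_of_real l / complex_of_real (M + 1)) < 1"
    using l p by (intro modular_scale_less_1) (auto simp: M_def)
  then show thesis
    using l by (intro that[of "l * (M + 1)"]) (auto simp: M_def add_nonneg_pos intro!: mult_pos_pos)
qed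

section \<open>The Bernstein singular integral\<close>

text \<open>A function of \<open>Lp_var p\<close> is, up to scaling, at most \<open>1\<close> plus its modular density: the first part is
  integrable against the integrable \<open>g\<close>, the second against the bounded \<open>g\<close>.\<close>

lemma integrable_bounded_translate_Lp:
  fixes f :: "real \<Rightarrow> complex" and g :: "real \<Rightarrow> real"
  assumes [measurable]: "f \<in> borel_measurable borel" "p \<in> borel_measurable borel"
    and p: "\<And>x. 1 \<le> p x" and l: "l > 0" "modular p (\<lambda>x. f x / complex_of_real l) < \<infinity>"
    and g: "integrable lborel g" "\<And>t. 0 \<le> g t" "\<And>t. g t \<le> b" and c: "c \<noteq> 0"
  shows "integrable lborel (\<lambda>t. f (x + c * t) * complex_of_real (g t))"
proof (rule integrableI_bounded)
  have [measurable]: "g \<in> borel_measurable borel" using g(1) by simp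
  show "(\<lambda>t. f (x + c * t) * complex_of_real (g t)) \<in> borel_measurable lborel" by measurable
  have b: "b \<ge> 0" using g(2)[of 0] g(3)[of 0] by linarith
  let ?m = "\<lambda>y. cmod (f y / complex_of_real l) powr p y"
  have "(\<integral>\<^sup>+t. ennreal (norm (f (x + c * t) * complex_of_real (g t))) \<partial>lborel)
      \<le> (\<integral>\<^sup>+t. ennreal (l * g t) + ennreal (l * b) * ennreal (?m (x + c * t)) \<partial>lborel)"
  proof (rule nn_integral_mono)
    fix t
    let ?y = "x + c * t"
    have y: "cmod (f ?y / complex_of_real l) \<le> 1 + ?m ?y"
      using p by (intro le_1_plus_powr) auto
    have "norm (f ?y * complex_of_real (g t)) = l * g t * cmod (f ?y / complex_of_real l)"
      using l(1) g(2)[of t] by (simp add: norm_mult norm_divide)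
    also have "\<dots> \<le> l * g t * (1 + ?m ?y)"
      using l(1) g(2)[of t] by (intro mult_left_mono y) auto
    also have "\<dots> = l * g t + l * g t * ?m ?y" by (simp add: ring_distribs)
    also have "\<dots> \<le> l * g t + l * b * ?m ?y"
      using l(1) g by (intro add_left_mono mult_right_mono mult_left_mono) auto
    finally have "ennreal (norm (f ?y * complex_of_real (g t))) \<le> ennreal (l * g t + l * b * ?m ?y)"
      by (rule ennreal_leI)
    also have "\<dots> = ennreal (l * g t) + ennreal (l * b) * ennreal (?m ?y)"
      using l(1) g(2)[of t] b by (simp add: ennreal_mult')
    finally show "ennreal (norm (f ?y * complex_of_real (g t))) \<le> ennreal (l * g t) + ennreal (l * b) * ennreal (?m ?y)" .
  qed
  also have "\<dots> = (\<integral>\<^sup>+t. ennreal (l * g t) \<partial>lborel) + ennreal (l * b) * (\<integral>\<^sup>+t. ennreal (?m (x + c * t)) \<partial>lborel)"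
    by (subst nn_integral_add) (auto simp: nn_integral_cmult)
  also have "\<dots> < \<infinity>"
  proof -
    have "integrable lborel (\<lambda>t. l * g t)" using g(1) by simp
    then have "(\<integral>\<^sup>+t. ennreal (l * g t) \<partial>lborel) = ennreal (LINT t|lborel. l * g t)"
      using l(1) g(2) by (intro nn_integral_eq_integral) auto
    moreover have "ennreal \<bar>c\<bar> * (\<integral>\<^sup>+t. ennreal (?m (x + c * t)) \<partial>lborel) < \<infinity>"
      using l(2) nn_integral_real_affine[of "\<lambda>y. ennreal (?m y)" c x] c by (simp add: modular_eq_lborel)
    then have "(\<integral>\<^sup>+t. ennreal (?m (x + c * t)) \<partial>lborel) < \<infinity>"
      using c by (auto simp: ennreal_mult_less_top)
    ultimately show ?thesis by (simp add: ennreal_mult_less_top)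
  qed
  finally show "(\<integral>\<^sup>+t. ennreal (norm (f (x + c * t) * complex_of_real (g t))) \<partial>lborel) < \<infinity>" .
qed

lemma bernstein_g_bounded:
  assumes "\<sigma> > 0" "r \<ge> 1"
  shows "bernstein_g \<sigma> r t \<le> (\<sigma> / (2 * real r)) ^ (2 * r)"
  unfolding bernstein_g_eq[OF assms]
  using mult_left_mono[OF sinc_power_le_1, of "(\<sigma> / (2 * real r)) ^ (2 * r)"] assms by simp

text \<open>Substituting \<open>u = x + v * t\<close> in the term of index \<open>v\<close> turns the operator into a combination of the
  values \<open>f (x + v * t)\<close> averaged against the kernel \<open>g\<close>; with \<open>f x\<close> as the term \<open>v = 0\<close> this is the
  \<open>k\<close>-th difference of \<open>f\<close> with step \<open>t\<close>.\<close>

lemma diff_bernstein_D_eq: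
  assumes [measurable]: "f \<in> borel_measurable borel" "p \<in> borel_measurable borel"
    and p: "\<And>x. 1 \<le> p x" and f: "f \<in> Lp_var p" and \<sigma>: "\<sigma> > 0" and r: "r \<ge> 1"
  shows "f x - bernstein_D \<sigma> r k f x = complex_of_real ((-1) ^ k / bernstein_gamma r \<sigma>) *
      (LINT t|lborel. forward_difference k t f x * complex_of_real (bernstein_g \<sigma> r t))"
    and "integrable lborel (\<lambda>t. forward_difference k t f x * complex_of_real (bernstein_g \<sigma> r t))"
proof -
  let ?g = "\<lambda>t. complex_of_real (bernstein_g \<sigma> r t)" and ?\<gamma> = "bernstein_gamma r \<sigma>"
  note gamma = bernstein_gamma_eq[OF \<sigma> r]
  obtain l where l: "l > 0" "modular p (\<lambda>x. f x / complex_of_real l) < \<infinity>"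
    using f by (auto simp: Lp_var_def)
  have int0: "integrable lborel (\<lambda>t. f (x + real v * t) * ?g t)" for v
  proof (cases "v = 0")
    case True
    then show ?thesis using gamma(3) by simp
  next
    case False
    then show ?thesis
      by (intro integrable_bounded_translate_Lp[OF assms(1,2) p l gamma(3)])
        (auto intro: bernstein_g_nonneg bernstein_g_bounded[OF \<sigma> r])
  qed
  let ?J = "\<lambda>v. LINT t|lborel. f (x + real v * t) * ?g t"
  let ?w = "\<lambda>v. (-1) ^ (k + v) * complex_of_nat (k choose v)"
  have fd: "forward_difference k t f x * ?g t = (\<Sum>v\<le>k. ?w v * (f (x + real v * t) * ?g t))" for t
    unfolding forward_difference_eq_sum sum_distrib_right by (simp only: mult.assoc)
  show "integrable lborel (\<lambda>t. forward_difference k t f x * ?g t)"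
    unfolding fd by (intro Bochner_Integration.integrable_sum integrable_mult_right int0)
  have "(LINT t|lborel. forward_difference k t f x * ?g t) = (\<Sum>v\<le>k. ?w v * ?J v)"
    unfolding fd using int0 by (subst Bochner_Integration.integral_sum) auto
  also have "\<dots> = (-1) ^ k * f x * complex_of_real ?\<gamma> + (\<Sum>v=1..k. ?w v * ?J v)"
  proof -
    have "?J 0 = f x * complex_of_real ?\<gamma>" using gamma(2) by simp
    moreover have "{..k} = insert 0 {1..k}" by auto
    ultimately show ?thesis by simp
  qed
  finally have L: "(LINT t|lborel. forward_difference k t f x * ?g t)
      = (-1) ^ k * f x * complex_of_real ?\<gamma> + (\<Sum>v=1..k. ?w v * ?J v)" .
  have K: "(LINT u|lebesgue. f u * complex_of_real (bernstein_G \<sigma> r k (u - x))) = (\<Sum>v=1..k. ?w v * ?J v)"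
  proof -
    let ?h = "\<lambda>v u. f u * ?g ((u - x) / real v)"
    have sub: "?h v (x + real v * t) = f (x + real v * t) * ?g t" if "v \<in> {1..k}" for v t
      using that by simp
    have inth: "integrable lborel (?h v)" and Jh: "(LINT u|lborel. ?h v u) = real v * ?J v" if v: "v \<in> {1..k}" for v
    proof -
      have nz: "real v \<noteq> 0" using v by simp
      show "integrable lborel (?h v)"
        using int0[of v] lborel_integrable_real_affine_iff[OF nz, of "?h v" x] unfolding sub[OF v] by simp
      show "(LINT u|lborel. ?h v u) = real v * ?J v"
        using lborel_integral_real_affine[OF nz, of "?h v" x] unfolding sub[OF v] by (simp add: scaleR_conv_of_real)
    qed
    let ?c = "\<lambda>v. (-1) ^ (k - v) * (1 / complex_of_nat v) * complex_of_nat (k choose v)"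
    have "(LINT u|lebesgue. f u * complex_of_real (bernstein_G \<sigma> r k (u - x)))
        = (LINT u|lborel. f u * complex_of_real (bernstein_G \<sigma> r k (u - x)))"
      by (rule integral_completion) (simp add: bernstein_G_def)
    also have "\<dots> = (LINT u|lborel. (\<Sum>v=1..k. ?c v * ?h v u))"
      by (simp add: bernstein_G_def sum_distrib_left mult_ac)
    also have "\<dots> = (\<Sum>v=1..k. ?c v * (LINT u|lborel. ?h v u))"
      using inth by (subst Bochner_Integration.integral_sum) auto
    also have "\<dots> = (\<Sum>v=1..k. ?w v * ?J v)"
    proof (rule sum.cong[OF refl])
      fix v assume v: "v \<in> {1..k}"
      have "(-1 :: complex) ^ (k - v) = (-1) ^ (k + v)"
        using v by (simp add: minus_one_power_iff)
      then show "?c v * (LINT u|lborel. ?h v u) = ?w v * ?J v"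
        using v unfolding Jh[OF v] by simp
    qed
    finally show ?thesis .
  qed
  have sign: "s / G * (s * y * G + S) = y - - (s / G) * S" if "s * s = 1" "G \<noteq> 0" for s G y S :: complex
  proof -
    have "s / G * (s * y * G + S) = (s * s) * y + s / G * S" using that(2) by (simp add: field_simps)
    then show ?thesis using that(1) by simp
  qed
  show "f x - bernstein_D \<sigma> r k f x = complex_of_real ((-1) ^ k / ?\<gamma>) *
      (LINT t|lborel. forward_difference k t f x * ?g t)"
    unfolding bernstein_D_def K L
    using sign[of "(-1) ^ k" "complex_of_real ?\<gamma>" "f x" "\<Sum>v=1..k. ?w v * ?J v"] gamma(4)
    by (simp flip: power_mult_distrib)
qed

lemma bernstein_D_measurable:
  assumes [measurable]: "f \<in> borel_measurable borel"
  shows "bernstein_D \<sigma> r k f \<in> borel_measurable borel"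
proof -
  have [measurable]: "bernstein_G \<sigma> r k \<in> borel_measurable borel"
    unfolding bernstein_G_def by measurable
  have "(\<lambda>x. LINT u|lborel. f u * complex_of_real (bernstein_G \<sigma> r k (u - x))) \<in> borel_measurable borel"
    by measurable
  moreover have "(LINT u|lebesgue. f u * complex_of_real (bernstein_G \<sigma> r k (u - x)))
      = (LINT u|lborel. f u * complex_of_real (bernstein_G \<sigma> r k (u - x)))" for x
    by (rule integral_completion) measurable
  ultimately show ?thesis unfolding bernstein_D_def[abs_def] by simp
qed

lemma Lp_var_subset_bernstein_domain:
  assumes p: "\<And>x. 1 \<le> p x" "p \<in> borel_measurable lebesgue" and f: "f \<in> Lp_var p" and r: "r \<ge> 1"
  shows "f \<in> bernstein_domain r"
proof -
  from f obtain l where l: "l > 0" "modular p (\<lambda>x. f x / complex_of_real l) < \<infinity>"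
    and [measurable]: "f \<in> borel_measurable lebesgue" by (auto simp: Lp_var_def)
  note [measurable] = p(2)
  let ?m = "\<lambda>y. cmod (f y / complex_of_real l) powr p y"
  have "(\<integral>\<^sup>+u. ennreal (cmod (f u) / (1 + u ^ (2 * r))) \<partial>lebesgue)
      \<le> (\<integral>\<^sup>+u. ennreal (2 * l * inverse (1 + u\<^sup>2)) + ennreal l * ennreal (?m u) \<partial>lebesgue)"
  proof (rule nn_integral_mono)
    fix u :: real
    have pos: "1 + u ^ (2 * r) \<ge> 1" by (simp add: zero_le_even_power)
    have m: "cmod (f u / complex_of_real l) \<le> 1 + ?m u"
      using p by (intro le_1_plus_powr) auto
    have w: "1 / (1 + u ^ (2 * r)) \<le> 2 * inverse (1 + u\<^sup>2)"
    proof -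
      have "1 + u\<^sup>2 \<le> 2 * (1 + u ^ (2 * r))"
      proof (cases "u\<^sup>2 \<le> 1")
        case True
        then have "1 + u\<^sup>2 \<le> 2 * 1" by simp
        also have "\<dots> \<le> 2 * (1 + u ^ (2 * r))" using pos by (rule mult_left_mono) simp
        finally show ?thesis .
      next
        case False
        then have "(u\<^sup>2) ^ 1 \<le> (u\<^sup>2) ^ r" using r by (intro power_increasing) auto
        then have "u\<^sup>2 \<le> 1 + u ^ (2 * r)" by (simp add: power_mult add_increasing)
        moreover have "1 \<le> 1 + u ^ (2 * r)" by (rule pos)
        ultimately show ?thesis unfolding mult_2 by (intro add_mono)
      qed
      then show ?thesis using pos by (simp add: field_simps add_pos_nonneg)
    qed
    have w1: "1 / (1 + u ^ (2 * r)) \<le> 1"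
      by (subst divide_le_eq_1_pos[OF less_le_trans[OF zero_less_one pos]]) (rule pos)
    have "cmod (f u) / (1 + u ^ (2 * r)) = l * cmod (f u / complex_of_real l) * (1 / (1 + u ^ (2 * r)))"
      using l by (simp add: norm_divide)
    also have "\<dots> \<le> l * (1 + ?m u) * (1 / (1 + u ^ (2 * r)))"
      using l pos by (intro mult_right_mono mult_left_mono m) auto
    also have "\<dots> = l * (1 / (1 + u ^ (2 * r))) + l * ?m u * (1 / (1 + u ^ (2 * r)))"
      by (simp only: ring_distribs mult_1_right)
    also have "\<dots> \<le> l * (2 * inverse (1 + u\<^sup>2)) + l * ?m u * 1"
      using l by (intro add_mono mult_left_mono w w1) auto
    finally have "ennreal (cmod (f u) / (1 + u ^ (2 * r))) \<le> ennreal (2 * l * inverse (1 + u\<^sup>2) + l * ?m u)"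
      by (intro ennreal_leI) (simp add: mult_ac)
    also have "\<dots> = ennreal (2 * l * inverse (1 + u\<^sup>2)) + ennreal l * ennreal (?m u)"
      using l by (simp add: ennreal_mult' add_nonneg_nonneg)
    finally show "ennreal (cmod (f u) / (1 + u ^ (2 * r))) \<le> ennreal (2 * l * inverse (1 + u\<^sup>2)) + ennreal l * ennreal (?m u)" .
  qed
  also have "\<dots> = (\<integral>\<^sup>+u. ennreal (2 * l * inverse (1 + u\<^sup>2)) \<partial>lborel) + ennreal l * modular p (\<lambda>x. f x / complex_of_real l)"
  proof -
    have [measurable]: "(\<lambda>u. ennreal (2 * l * inverse (1 + u\<^sup>2))) \<in> borel_measurable lebesgue"
      by (intro measurable_completion) measurable
    have [measurable]: "(\<lambda>u. ennreal (?m u)) \<in> borel_measurable lebesgue" by measurable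
    show ?thesis
      unfolding modular_def nn_integral_completion[of lborel "\<lambda>u. ennreal (2 * l * inverse (1 + u\<^sup>2))", symmetric]
      by (subst nn_integral_add, measurable, subst nn_integral_cmult, measurable)
  qed
  also have "\<dots> < \<infinity>"
  proof -
    have "integrable lborel (\<lambda>s::real. 2 * l * inverse (1 + s\<^sup>2))"
      using integrable_inverse_1_plus_square by (simp add: set_integrable_def)
    then have "(\<integral>\<^sup>+s. ennreal (2 * l * inverse (1 + s\<^sup>2)) \<partial>lborel) = ennreal (LINT s|lborel. 2 * l * inverse (1 + s\<^sup>2))"
      using l by (intro nn_integral_eq_integral) (auto simp: add_pos_nonneg less_imp_le)
    then show ?thesis using l by (simp add: ennreal_mult_less_top)
  qed
  finally show ?thesis by (simp add: bernstein_domain_def)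
qed

section \<open>The approximation estimate\<close>

lemma ac_increment_le_nn_integral:
  fixes f :: "real \<Rightarrow> complex"
  assumes f: "ac_on_divisions f" and h: "h = (\<lambda>x. vector_derivative f (at x))"
    and [measurable]: "h \<in> borel_measurable lebesgue" and ab: "a \<le> b"
  shows "ennreal (cmod (f b - f a)) \<le> (\<integral>\<^sup>+y. ennreal (cmod (h y)) * indicator {a..b} y \<partial>lborel)"
proof -
  have eq: "(\<integral>\<^sup>+y. ennreal (cmod (h y)) * indicator {a..b} y \<partial>lborel)
      = (\<integral>\<^sup>+y. ennreal (norm (indicat_real {a..b} y *\<^sub>R h y)) \<partial>lebesgue)"
    unfolding nn_integral_completion by (intro nn_integral_cong) (auto simp: indicator_def)
  show ?thesis
  proof (cases "(\<integral>\<^sup>+y. ennreal (norm (indicat_real {a..b} y *\<^sub>R h y)) \<partial>lebesgue) < \<infinity>")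
    case True
    then have int: "set_integrable lebesgue {a..b} h"
      unfolding set_integrable_def
      by (intro integrableI_bounded borel_measurable_scaleR borel_measurable_indicator) auto
    have "(h has_integral (f b - f a)) {a..b}"
      by (rule ac_fundamental_theorem[OF f ab ac_complex_differentiable_ae[OF f]])
        (simp add: h vector_derivative_works)
    moreover have "(h has_integral (LINT x:{a..b}|lebesgue. h x)) {a..b}"
      using int by (rule has_integral_set_lebesgue)
    ultimately have "f b - f a = (LINT x:{a..b}|lebesgue. h x)"
      by (rule has_integral_unique)
    then show ?thesis
      unfolding eq set_lebesgue_integral_def
      using integral_norm_bound_ennreal[OF int[unfolded set_integrable_def]] by simp
  next
    case False
    then show ?thesis unfolding eq by (simp add: not_less top_unique)
  qed
qed

lemma sobolev_continuous:
  assumes "f \<in> sobolev k p" "k \<ge> 1"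
  shows "continuous_on UNIV f"
proof (cases "k = 1")
  case True
  then have "ac_on_divisions f"
    using assms by (auto simp: sobolev_def intro: abs_continuous_imp_ac_on_divisions)
  then show ?thesis by (simp add: ac_on_divisions_isCont continuous_at_imp_continuous_on)
next
  case False
  moreover have "\<forall>j<k - 1. \<forall>x. nth_deriv j f differentiable at x" using assms(1) by (simp add: sobolev_def)
  ultimately have "nth_deriv 0 f differentiable (at x)" for x using assms(2) by (metis diff_is_0_eq' le_neq_implies_less le_zero_eq less_one nat_less_le zero_less_diff)
  then have "isCont f x" for x by (simp add: differentiable_imp_continuous_within)
  then show ?thesis by (simp add: continuous_at_imp_continuous_on)
qed

lemma sobolev_forward_difference_le:
  assumes f: "f \<in> sobolev k p" and k: "k \<ge> 1" and t: "t \<noteq> 0"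
    and fin: "(\<integral>\<^sup>+y. ennreal (cmod (nth_deriv k f y)) * indicator {x - real k * \<bar>t\<bar>..x + real k * \<bar>t\<bar>} y \<partial>lborel) \<le> ennreal B"
    and B: "B \<ge> 0"
  shows "cmod (forward_difference k t f x) \<le> \<bar>t\<bar> ^ (k - 1) * B"
proof -
  let ?h = "nth_deriv k f"
  obtain n where n: "k = Suc n" using k by (cases k) auto
  have ac: "ac_on_divisions (nth_deriv n f)" and hm: "?h \<in> borel_measurable lebesgue"
    using f by (auto simp: sobolev_def n Lp_var_def simp del: nth_deriv.simps intro: abs_continuous_imp_ac_on_divisions)
  have inc: "ennreal (cmod (nth_deriv n f b - nth_deriv n f a)) \<le> ennreal B"
    if "a \<le> b" "x - real k * \<bar>t\<bar> \<le> a" "b \<le> x + real k * \<bar>t\<bar>" for a b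
  proof -
    have "ennreal (cmod (nth_deriv n f b - nth_deriv n f a)) \<le>
        (\<integral>\<^sup>+y. ennreal (cmod (?h y)) * indicator {a..b} y \<partial>lborel)"
      using ac that(1) hm by (intro ac_increment_le_nn_integral) (auto simp: n)
    also have "\<dots> \<le> (\<integral>\<^sup>+y. ennreal (cmod (?h y)) * indicator {x - real k * \<bar>t\<bar>..x + real k * \<bar>t\<bar>} y \<partial>lborel)"
      using that by (intro nn_integral_mono mult_left_mono) (auto simp: indicator_def)
    also note fin
    finally show ?thesis .
  qed
  have "norm (forward_difference (Suc n) t ((\<lambda>j. nth_deriv j f) 0) x) \<le> \<bar>t\<bar> ^ n * B"
  proof (rule forward_difference_norm_le)
    fix j y assume "j < n"
    then have "nth_deriv j f differentiable (at y)" using f by (auto simp: sobolev_def n)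
    then show "(nth_deriv j f has_vector_derivative nth_deriv (Suc j) f y) (at y)"
      by (simp add: vector_derivative_works)
  next
    fix z assume z: "\<bar>z - x\<bar> \<le> real n * \<bar>t\<bar>"
    have kt: "real k * \<bar>t\<bar> = real n * \<bar>t\<bar> + \<bar>t\<bar>" by (simp add: n algebra_simps)
    have "ennreal (norm (nth_deriv n f (z + t) - nth_deriv n f z)) \<le> ennreal B"
    proof (cases "t > 0")
      case True
      then show ?thesis using z kt by (intro inc) auto
    next
      case False
      then have "ennreal (cmod (nth_deriv n f z - nth_deriv n f (z + t))) \<le> ennreal B"
        using z kt by (intro inc) auto
      then show ?thesis by (simp add: norm_minus_commute)
    qed
    then show "norm (nth_deriv n f (z + t) - nth_deriv n f z) \<le> B"
      using B by (simp add: ennreal_le_iff)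
  qed
  then show ?thesis by (simp add: n)
qed

text \<open>\<open>jackson_constant r k / \<sigma> ^ k\<close> is \<open>2 * k\<close> times the moment of order \<open>k\<close> of the kernel divided by its total
  mass \<open>bernstein_gamma r \<sigma>\<close>.\<close>

definition jackson_constant :: "nat \<Rightarrow> nat \<Rightarrow> real" where
  "jackson_constant r k = 2 * real k * (2 * real r) ^ k * moment r k / moment r 0"

lemma jackson_constant_pos:
  assumes "k \<ge> 1" "k + 2 \<le> 2 * r"
  shows "jackson_constant r k > 0"
  using assms moment_pos[of k r] moment_pos[of 0 r] by (simp add: jackson_constant_def)

context log_exponent
begin

text \<open>The \<open>k\<close>-th difference with step \<open>t\<close> is at most \<open>2 * k * \<bar>t\<bar> ^ k\<close> times the average of the modulus of the
  derivative of order \<open>k\<close> over the interval of radius \<open>k * \<bar>t\<bar>\<close>.  The error is therefore dominated by a mixture of such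
  averages with weight proportional to \<open>g t * \<bar>t\<bar> ^ k\<close>, and by Jensen's inequality for this mixture the bound for
  single averages survives.\<close>

theorem modular_diff_bernstein_D_le:
  assumes f: "f \<in> sobolev k p" and k: "k \<ge> 1" and r: "k + 2 \<le> 2 * r" and \<sigma>: "\<sigma> > 0"
    and \<eta>: "\<eta> > 0" and mod: "modular p (\<lambda>x. nth_deriv k f x / complex_of_real \<eta>) \<le> 1"
  shows "modular p (\<lambda>x. (f x - bernstein_D \<sigma> r k f x) / complex_of_real (jackson_constant r k / \<sigma> ^ k * \<eta>)) \<le> avg_bound"
proof -
  let ?h = "nth_deriv k f" and ?g = "bernstein_g \<sigma> r" and ?\<gamma> = "bernstein_gamma r \<sigma>"
  have r1: "r \<ge> 1" using r by auto
  note gamma = bernstein_gamma_eq[OF \<sigma> r1]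
  have [measurable]: "f \<in> borel_measurable borel"
    using sobolev_continuous[OF f k] by (rule borel_measurable_continuous_onI)
  have [measurable]: "?h \<in> borel_measurable lebesgue" and fL: "f \<in> Lp_var p"
    using f by (auto simp: sobolev_def Lp_var_def)
  have "(\<lambda>y. cmod (?h y) / \<eta>) \<in> borel_measurable lebesgue" by measurable
  \<comment> \<open>Averages are defined through Borel functions, but the derivative is only Lebesgue measurable.\<close>
  then obtain H' where [measurable]: "H' \<in> borel_measurable borel" and H': "AE y in lborel. cmod (?h y) / \<eta> = H' y"
    using completion_ex_borel_measurable_real[of "\<lambda>y. cmod (?h y) / \<eta>" lborel] by auto
  define H where "H y = max 0 (H' y)" for y
  have [measurable]: "H \<in> borel_measurable borel" unfolding H_def by measurable
  have H0: "H y \<ge> 0" for y by (simp add: H_def)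
  have H: "AE y in lborel. cmod (?h y) = \<eta> * H y"
    using H'
  proof eventually_elim
    case (elim y)
    then have "H' y \<ge> 0" using \<eta> by (metis divide_nonneg_pos norm_ge_zero)
    then show ?case using elim \<eta> by (simp add: H_def field_simps)
  qed
  have Hmod: "(\<integral>\<^sup>+y. ennreal (H y powr p y) \<partial>lborel) \<le> 1"
  proof -
    have "(\<integral>\<^sup>+y. ennreal (H y powr p y) \<partial>lborel) = modular p (\<lambda>x. ?h x / complex_of_real \<eta>)"
      unfolding modular_eq_lborel
    proof (rule nn_integral_cong_AE)
      show "AE y in lborel. ennreal (H y powr p y) = ennreal (cmod (?h y / complex_of_real \<eta>) powr p y)"
        using H by eventually_elim (use \<eta> in \<open>simp add: norm_divide\<close>)
    qed
    with mod show ?thesis by simp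
  qed
  define A where "A t x = enn2real (avg (real k * \<bar>t\<bar>) (\<lambda>y. ennreal (H y)) x)" for t x
  have [measurable]: "(\<lambda>(t, x). A t x) \<in> borel_measurable (borel \<Otimes>\<^sub>M borel)" unfolding A_def by measurable
  have A0: "A t x \<ge> 0" for t x by (simp add: A_def)
  have A: "avg (real k * \<bar>t\<bar>) (\<lambda>y. ennreal (H y)) x = ennreal (A t x)" if "t \<noteq> 0" for t x
  proof -
    have "avg (real k * \<bar>t\<bar>) (\<lambda>y. ennreal (H y)) x < top"
      using modular_avg_le(2)[OF _ H0 Hmod, of "real k * \<bar>t\<bar>" x] k that
      by (auto intro: order_le_less_trans)
    then show ?thesis by (simp add: A_def)
  qed
  have fd: "cmod (forward_difference k t f x) \<le> 2 * real k * \<eta> * (\<bar>t\<bar> ^ k * A t x)" if t: "t \<noteq> 0" for t x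
  proof -
    let ?B = "2 * (real k * \<bar>t\<bar>) * (\<eta> * A t x)"
    have kt: "real k * \<bar>t\<bar> > 0" using k t by simp
    have "(\<integral>\<^sup>+y. ennreal (cmod (?h y)) * indicator {x - real k * \<bar>t\<bar>..x + real k * \<bar>t\<bar>} y \<partial>lborel)
        = (\<integral>\<^sup>+y. (ennreal \<eta> * ennreal (H y)) * indicator {x - real k * \<bar>t\<bar>..x + real k * \<bar>t\<bar>} y \<partial>lborel)"
      using H by (intro nn_integral_cong_AE, eventually_elim) (use \<eta> in \<open>simp add: ennreal_mult'\<close>)
    also have "\<dots> = ennreal (2 * (real k * \<bar>t\<bar>)) * avg (real k * \<bar>t\<bar>) (\<lambda>y. ennreal \<eta> * ennreal (H y)) x"
      using kt by (intro avg_eq_interval[symmetric]) auto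
    also have "\<dots> = ennreal (2 * (real k * \<bar>t\<bar>)) * (ennreal \<eta> * ennreal (A t x))"
      by (subst avg_cmult) (auto simp: A[OF t])
    also have "\<dots> = ennreal ?B" using \<eta> A0[of t x] kt by (simp add: ennreal_mult')
    finally have "cmod (forward_difference k t f x) \<le> \<bar>t\<bar> ^ (k - 1) * ?B"
      using \<eta> A0[of t x] by (intro sobolev_forward_difference_le[OF f k t]) auto
    also have "\<dots> = 2 * real k * \<eta> * ((\<bar>t\<bar> ^ (k - 1) * \<bar>t\<bar>) * A t x)" by (simp add: mult_ac)
    also have "\<bar>t\<bar> ^ (k - 1) * \<bar>t\<bar> = \<bar>t\<bar> ^ k" using k by (simp add: power_eq_if mult.commute)
    finally show ?thesis .
  qed
  define a where "a = \<sigma> / (2 * real r)"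
  have a: "a > 0" using \<sigma> r1 by (simp add: a_def)
  define Z where "Z = a ^ (2 * r) / a ^ (k + 1) * moment r k"
  have Z0: "Z > 0" using a moment_pos[of k r] r by (simp add: Z_def)
  have Z: "(\<integral>\<^sup>+t. ennreal (?g t * \<bar>t\<bar> ^ k) \<partial>lborel) = ennreal Z"
    unfolding Z_def a_def by (rule nn_integral_bernstein_g_moment[OF \<sigma> r])
  define \<mu> where "\<mu> = density lborel (\<lambda>t. ennreal (?g t * \<bar>t\<bar> ^ k / Z))"
  have sets_\<mu> [measurable_cong, simp]: "sets \<mu> = sets borel" by (simp add: \<mu>_def)
  have g0: "?g t * \<bar>t\<bar> ^ k \<ge> 0" for t by (simp add: bernstein_g_nonneg)
  have "prob_space \<mu>"
  proof
    have "emeasure \<mu> (space \<mu>) = (\<integral>\<^sup>+t. ennreal (?g t * \<bar>t\<bar> ^ k / Z) \<partial>lborel)"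
      by (simp add: \<mu>_def emeasure_density)
    also have "\<dots> = (\<integral>\<^sup>+t. ennreal (?g t * \<bar>t\<bar> ^ k) * ennreal (1 / Z) \<partial>lborel)"
      using g0 by (intro nn_integral_cong) (simp flip: ennreal_mult')
    also have "\<dots> = ennreal Z * ennreal (1 / Z)"
      by (subst nn_integral_multc) (auto simp: Z)
    also have "\<dots> = 1" using Z0 by (simp flip: ennreal_mult')
    finally show "emeasure \<mu> (space \<mu>) = 1" .
  qed
  then interpret \<mu>: prob_space \<mu> .
  define \<kappa> where "\<kappa> = jackson_constant r k / \<sigma> ^ k * \<eta>"
  have \<kappa>0: "\<kappa> > 0" using jackson_constant_pos[OF k r] \<sigma> \<eta> by (simp add: \<kappa>_def)
  \<comment> \<open>The powers of the dilation factor cancel, except for \<open>a ^ k\<close>.\<close>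
  have \<kappa>: "\<kappa> = 2 * real k * \<eta> * Z / ?\<gamma>"
  proof -
    have "?\<gamma> = a ^ (2 * r) / a * moment r 0" unfolding a_def by (rule gamma(1))
    moreover have "\<sigma> = a * (2 * real r)" using r1 by (simp add: a_def)
    then have "\<sigma> ^ k = a ^ k * (2 * real r) ^ k" by (simp add: power_mult_distrib)
    ultimately show ?thesis
      using a moment_pos[of 0 r] r r1 unfolding \<kappa>_def jackson_constant_def Z_def
      by (simp add: field_simps)
  qed
  define F where "F x = f x - bernstein_D \<sigma> r k f x" for x
  have F: "ennreal (cmod (F x) / \<kappa>) \<le> (\<integral>\<^sup>+t. ennreal (A t x) \<partial>\<mu>)" for x
  proof -
    note D = diff_bernstein_D_eq[OF _ p_measurable p_ge_1 fL \<sigma> r1]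
    let ?\<Delta> = "\<lambda>t. forward_difference k t f x * complex_of_real (?g t)"
    have "cmod (F x) = 1 / ?\<gamma> * cmod (LINT t|lborel. ?\<Delta> t)"
      using gamma(4) unfolding F_def D(1)[OF \<open>f \<in> borel_measurable borel\<close>]
      by (simp add: norm_mult norm_divide norm_power)
    then have "ennreal (cmod (F x)) = ennreal (1 / ?\<gamma>) * ennreal (cmod (LINT t|lborel. ?\<Delta> t))"
      using gamma(4) by (simp add: ennreal_mult'[symmetric])
    also have "\<dots> \<le> ennreal (1 / ?\<gamma>) * (\<integral>\<^sup>+t. ennreal (cmod (?\<Delta> t)) \<partial>lborel)"
      by (intro mult_left_mono integral_norm_bound_ennreal D(2)) auto
    also have "\<dots> \<le> ennreal (1 / ?\<gamma>) * (\<integral>\<^sup>+t. ennreal (2 * real k * \<eta> * Z) * (ennreal (?g t * \<bar>t\<bar> ^ k / Z) * ennreal (A t x)) \<partial>lborel)"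
    proof (intro mult_left_mono nn_integral_mono_AE)
      have "AE t in lborel. t \<noteq> (0::real)" by (rule AE_lborel_singleton)
      then show "AE t in lborel. ennreal (cmod (?\<Delta> t)) \<le> ennreal (2 * real k * \<eta> * Z) * (ennreal (?g t * \<bar>t\<bar> ^ k / Z) * ennreal (A t x))"
      proof eventually_elim
        case (elim t)
        have "cmod (?\<Delta> t) \<le> 2 * real k * \<eta> * (\<bar>t\<bar> ^ k * A t x) * ?g t"
          using mult_right_mono[OF fd[OF elim, of x] bernstein_g_nonneg[of \<sigma> r t]]
          by (simp add: norm_mult bernstein_g_nonneg)
        also have "\<dots> = (2 * real k * \<eta> * Z) * ((?g t * \<bar>t\<bar> ^ k / Z) * A t x)"
          using Z0 by simp
        finally have "ennreal (cmod (?\<Delta> t)) \<le> ennreal ((2 * real k * \<eta> * Z) * ((?g t * \<bar>t\<bar> ^ k / Z) * A t x))"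
          by (rule ennreal_leI)
        also have "\<dots> = ennreal (2 * real k * \<eta> * Z) * (ennreal (?g t * \<bar>t\<bar> ^ k / Z) * ennreal (A t x))"
        proof -
          have "0 \<le> 2 * real k * \<eta> * Z" "0 \<le> ?g t * \<bar>t\<bar> ^ k / Z" using \<eta> Z0 g0[of t] by auto
          then show ?thesis by (simp only: ennreal_mult')
        qed
        finally show ?case .
      qed
    qed auto
    also have "\<dots> = ennreal (1 / ?\<gamma>) * (ennreal (2 * real k * \<eta> * Z) * (\<integral>\<^sup>+t. ennreal (A t x) \<partial>\<mu>))"
      unfolding \<mu>_def by (simp add: nn_integral_density nn_integral_cmult)
    also have "\<dots> = ennreal \<kappa> * (\<integral>\<^sup>+t. ennreal (A t x) \<partial>\<mu>)"
    proof -
      have "\<kappa> = 1 / ?\<gamma> * (2 * real k * \<eta> * Z)" by (simp add: \<kappa>)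
      then have "ennreal \<kappa> = ennreal (1 / ?\<gamma>) * ennreal (2 * real k * \<eta> * Z)"
        using gamma(4) by (simp only: ennreal_mult' zero_le_divide_1_iff less_imp_le)
      then show ?thesis by (simp only: mult.assoc)
    qed
    finally have "ennreal (cmod (F x)) \<le> ennreal \<kappa> * (\<integral>\<^sup>+t. ennreal (A t x) \<partial>\<mu>)" .
    then have "ennreal (1 / \<kappa>) * ennreal (cmod (F x)) \<le> ennreal (1 / \<kappa>) * (ennreal \<kappa> * (\<integral>\<^sup>+t. ennreal (A t x) \<partial>\<mu>))"
      by (rule mult_left_mono) simp
    also have "\<dots> = (\<integral>\<^sup>+t. ennreal (A t x) \<partial>\<mu>)"
      using \<kappa>0 by (simp flip: mult.assoc ennreal_mult')
    finally show ?thesis using \<kappa>0 by (simp add: ennreal_mult'[symmetric])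
  qed
  have "modular p (\<lambda>x. F x / complex_of_real \<kappa>) \<le> (\<integral>\<^sup>+x. (\<integral>\<^sup>+t. ennreal (A t x powr p x) \<partial>\<mu>) \<partial>lborel)"
    unfolding modular_eq_lborel
  proof (rule nn_integral_mono)
    fix x
    have "ennreal ((cmod (F x) / \<kappa>) powr p x) \<le> (\<integral>\<^sup>+t. ennreal (A t x powr p x) \<partial>\<mu>)"
      using \<kappa>0 A0 p_ge_1 F by (intro \<mu>.powr_le_nn_integral_powr) auto
    then show "ennreal (cmod (F x / complex_of_real \<kappa>) powr p x) \<le> (\<integral>\<^sup>+t. ennreal (A t x powr p x) \<partial>\<mu>)"
      using \<kappa>0 by (simp add: norm_divide)
  qed
  also have "\<dots> = (\<integral>\<^sup>+t. (\<integral>\<^sup>+x. ennreal (A t x powr p x) \<partial>lborel) \<partial>\<mu>)"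
  proof -
    interpret pair_sigma_finite lborel \<mu> ..
    show ?thesis by (rule Fubini'[symmetric]) measurable
  qed
  also have "\<dots> \<le> (\<integral>\<^sup>+t. avg_bound \<partial>\<mu>)"
  proof (rule nn_integral_mono_AE)
    have "AE t in lborel. t \<noteq> (0::real)" by (rule AE_lborel_singleton)
    then have "AE t in lborel. (\<integral>\<^sup>+x. ennreal (A t x powr p x) \<partial>lborel) \<le> avg_bound"
    proof eventually_elim
      case (elim t)
      then have "real k * \<bar>t\<bar> > 0" using k by simp
      then show ?case unfolding A_def by (intro modular_avg_le(1) H0 Hmod) auto
    qed
    then show "AE t in \<mu>. (\<integral>\<^sup>+x. ennreal (A t x powr p x) \<partial>lborel) \<le> avg_bound"
      unfolding \<mu>_def by (subst AE_density) auto
  qed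
  also have "\<dots> = avg_bound" by (simp add: \<mu>.emeasure_space_1)
  finally show ?thesis unfolding F_def \<kappa>_def .
qed

theorem norm_diff_bernstein_D_le:
  assumes f: "f \<in> sobolev k p" and k: "k \<ge> 1" and r: "k + 2 \<le> 2 * r" and \<sigma>: "\<sigma> > 0"
  shows "(\<lambda>x. f x - bernstein_D \<sigma> r k f x) \<in> Lp_var p"
    and "norm_var p (\<lambda>x. f x - bernstein_D \<sigma> r k f x) \<le>
      jackson_constant r k * (enn2real avg_bound + 1) / \<sigma> ^ k * norm_var p (nth_deriv k f)"
proof -
  let ?F = "\<lambda>x. f x - bernstein_D \<sigma> r k f x" and ?h = "nth_deriv k f"
  define M where "M = enn2real avg_bound"
  have M: "avg_bound = ennreal M" "M \<ge> 0" using avg_bound_finite by (auto simp: M_def)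
  define c where "c = jackson_constant r k * (M + 1) / \<sigma> ^ k"
  have c: "c > 0" using jackson_constant_pos[OF k r] \<sigma> M by (simp add: c_def add_nonneg_pos)
  have fb [measurable]: "f \<in> borel_measurable borel"
    using sobolev_continuous[OF f k] by (rule borel_measurable_continuous_onI)
  have "?F \<in> borel_measurable borel" using bernstein_D_measurable[OF fb] by measurable
  then have Fm [measurable]: "?F \<in> borel_measurable lebesgue" by (intro measurable_completion) simp
  have pm [measurable]: "p \<in> borel_measurable lebesgue" using p_measurable by (intro measurable_completion) simp
  have scale: "modular p (\<lambda>x. ?F x / complex_of_real (c * \<eta>)) < 1"
    if "\<eta> > 0" "modular p (\<lambda>x. ?h x / complex_of_real \<eta>) < 1" for \<eta>
  proof -
    let ?\<kappa> = "jackson_constant r k / \<sigma> ^ k * \<eta>"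
    have "modular p (\<lambda>x. ?F x / complex_of_real ?\<kappa> / complex_of_real (M + 1)) < 1"
      using modular_diff_bernstein_D_le[OF f k r \<sigma> that(1)] that(2) M p_ge_1
      by (intro modular_scale_less_1) auto
    moreover have "?F x / complex_of_real ?\<kappa> / complex_of_real (M + 1) = ?F x / complex_of_real (c * \<eta>)" for x
      by (simp add: c_def mult_ac)
    ultimately show ?thesis by simp
  qed
  let ?S = "\<lambda>g. {\<eta>. \<eta> > 0 \<and> modular p (\<lambda>x. g x / complex_of_real \<eta>) < 1}"
  obtain \<eta> where \<eta>: "\<eta> > 0" "modular p (\<lambda>x. ?h x / complex_of_real \<eta>) < 1"
    using Lp_var_modular_less_1[of ?h p] f p_ge_1 pm by (auto simp: sobolev_def)
  show "?F \<in> Lp_var p"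
  proof -
    have "modular p (\<lambda>x. ?F x / complex_of_real (c * \<eta>)) < \<infinity>"
      using scale[OF \<eta>] by (rule order_less_trans) simp
    moreover have "c * \<eta> > 0" using c \<eta> by simp
    ultimately show ?thesis using Fm unfolding Lp_var_def by blast
  qed
  have "norm_var p ?F / c \<le> Inf (?S ?h)"
  proof (rule cInf_greatest)
    show "?S ?h \<noteq> {}" using \<eta> by blast
    fix \<eta> assume "\<eta> \<in> ?S ?h"
    then have "c * \<eta> \<in> ?S ?F" using c scale by simp
    then have "norm_var p ?F \<le> c * \<eta>"
      unfolding norm_var_def by (rule cInf_lower) (auto intro: bdd_belowI[of _ 0])
    then show "norm_var p ?F / c \<le> \<eta>" using c by (simp add: divide_le_eq mult.commute)
  qed
  then have "norm_var p ?F \<le> c * norm_var p ?h"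
    using c by (simp add: norm_var_def divide_le_eq mult.commute)
  then show "norm_var p ?F \<le> jackson_constant r k * (enn2real avg_bound + 1) / \<sigma> ^ k * norm_var p ?h"
    by (simp add: c_def M_def)
qed

end

theorem theorem5p8:
  fixes p :: "real \<Rightarrow> real" and k r :: nat
  assumes "p \<in> log_exponents"
    and "k \<ge> 1"
    and "r = nat \<lceil>(real k + 2) / 2\<rceil>"
  shows "\<exists>C>0. \<forall>\<sigma>>0. \<forall>f\<in>sobolev k p.
    f \<in> bernstein_domain r \<and>
    (\<lambda>x. f x - bernstein_D \<sigma> r k f x) \<in> Lp_var p \<and>
    norm_var p (\<lambda>x. f x - bernstein_D \<sigma> r k f x) \<le> C / \<sigma> ^ k * norm_var p (nth_deriv k f)"
proof -
  obtain c1 c2 c3 where c: "c1 > 0" "c2 > 0"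
    "\<And>x y. \<bar>p x - p y\<bar> * ln (exp 1 + 1 / \<bar>x - y\<bar>) \<le> c1" "\<And>x. \<bar>p x - c3\<bar> * ln (exp 1 + \<bar>x\<bar>) \<le> c2"
    using assms(1) unfolding log_exponents_def by blast
  have p1: "1 \<le> p x" and pm: "p \<in> borel_measurable lebesgue" for x
    using assms(1) by (auto simp: log_exponents_def exponents_def)
  interpret log_exponent p c1 c2 c3
    by standard (use c p1 in auto)
  have "(real k + 2) / 2 \<le> real r"
    unfolding assms(3) by linarith
  then have "real (k + 2) \<le> real (2 * r)" by simp
  then have kr: "k + 2 \<le> 2 * r" by (simp only: of_nat_le_iff)
  then have r: "r \<ge> 1" by simp
  let ?C = "jackson_constant r k * (enn2real avg_bound + 1)"
  have "?C > 0" using jackson_constant_pos[OF assms(2) kr] by (simp add: add_nonneg_pos)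
  moreover have "f \<in> bernstein_domain r" if "f \<in> sobolev k p" for f
    using that p1 pm r by (intro Lp_var_subset_bernstein_domain) (auto simp: sobolev_def)
  ultimately show ?thesis
    using norm_diff_bernstein_D_le[OF _ assms(2) kr] by (intro exI[of _ ?C]) auto
qed

end
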